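(* Let $b\in\{1,\dots,n\}$, $p\in(0,1]$, and run L-SVRG-D (described in the context) with $b$-nice sampling and initial step size $\alpha=\frac1{2\zeta_p\mathcal L(b)}$, where $$\mathcal L(b)=\frac1b\frac{n-b}{n-1}L_{\max}+\frac nb\frac{b-1}{n-1}L,\qquad\zeta_p=\frac{(7-4p)\left(1-(1-p)^{3/2}\right)}{p(2-p)(3-2p)}.$$ Then for every $\epsilon>0$ the total complexity (number of individual gradient evaluations, counting the expected cost $2b+pn$ per iteration) of finding an $\epsilon$-approximate solution satisfying $\mathbb E\|x^k-x^*\|_2^2\le\epsilon\,\phi^0$ is $$C_p(b):=2(2b+pn)\max\left\{\frac{3\zeta_p}2\frac{\mathcal L(b)}\mu,\ \frac1p\right\}\log\left(\frac1\epsilon\right).$$ That is, for every integer $k\ge0$ with $k\,(2b+pn)\ge C_p(b)$, one has $\mathbb E\|x^k-x^*\|_2^2\le\epsilon\,\phi^0$. Here $\phi^0=\|x^0-x^*\|_2^2+\frac{8\alpha^2\mathcal L(b)}{p(3-2p)}(f(w^0)-f(x^* ))$.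
   Context: Setting: $n\ge2$, $f(x)=\frac1n\sum_{i=1}^n f_i(x)$ on $\mathbb R^d$ with minimizer $x^*$; $f$ is $L$-smooth, i.e. $f(x)\le f(y)+\langle\nabla f(y),x-y\rangle+\frac L2\|x-y\|_2^2$, and $\mu$-strongly convex with $\mu>0$, i.e. $f(x)\le f(y)+\langle\nabla f(x),x-y\rangle-\frac\mu2\|x-y\|_2^2$, for all $x,y$. Each $f_i$ is differentiable, convex and $L_i$-smooth; $L_{\max}=\max_iL_i$. $b$-nice sampling: $B\subseteq\{1,\dots,n\}$ is drawn uniformly among all subsets of size $b$; the associated sampling vector is $v=\frac nb\sum_{i\in B}e_i$, so $\nabla f_v(x)=\frac1b\sum_{i\in B}\nabla f_i(x)$. L-SVRG-D: initialize $w^0=x^0\in\mathbb R^d$ (deterministic) and $\alpha_0=\alpha$. For $k=0,1,2,\dots$: sample an independent copy $v_k$ of $v$, set $g^k=\nabla f_{v_k}(x^k)-\nabla f_{v_k}(w^k)+\nabla f(w^k)$ and $x^{k+1}=x^k-\alpha_kg^k$; then toss an independent coin and set $(w^{k+1},\alpha_{k+1})=(x^k,\alpha)$ with probability $p$, and $(w^{k+1},\alpha_{k+1})=(w^k,\sqrt{1-p}\,\alpha_k)$ with probability $1-p$. Each iteration costs in expectation $2b+pn$ evaluations of individual gradients $\nabla f_i$. *)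

theory Defs
  imports "HOL-Analysis.Analysis" "HOL-Probability.Probability"
begin

text \<open>Only meaningful where the function is differentiable.\<close>

definition grad :: "('a::euclidean_space \<Rightarrow> real) \<Rightarrow> 'a \<Rightarrow> 'a" where
  "grad h x = (THE D. GDERIV h x :> D)"

definition smooth_with :: "real \<Rightarrow> ('a::euclidean_space \<Rightarrow> real) \<Rightarrow> bool" where
  "smooth_with L h \<longleftrightarrow>
     (\<forall>x y. h x \<le> h y + grad h y \<bullet> (x - y) + L / 2 * (norm (x - y))\<^sup>2)"

text \<open>The gradient is taken at the point on the left-hand side, so that exchanging the two
  points gives the usual lower bound by a quadratic.\<close>

definition strongly_convex_with :: "real \<Rightarrow> ('a::euclidean_space \<Rightarrow> real) \<Rightarrow> bool" where
  "strongly_convex_with \<mu> h \<longleftrightarrow>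
     (\<forall>x y. h x \<le> h y + grad h x \<bullet> (x - y) - \<mu> / 2 * (norm (x - y))\<^sup>2)"

definition f_avg :: "nat \<Rightarrow> (nat \<Rightarrow> 'a::euclidean_space \<Rightarrow> real) \<Rightarrow> 'a \<Rightarrow> real" where
  "f_avg n f x = 1 / real n * (\<Sum>i = 1..n. f i x)"

definition f_sub ::
  "nat \<Rightarrow> (nat \<Rightarrow> 'a::euclidean_space \<Rightarrow> real) \<Rightarrow> (nat \<Rightarrow> real) \<Rightarrow> 'a \<Rightarrow> real" where
  "f_sub n f v x = 1 / real n * (\<Sum>i = 1..n. v i * f i x)"

text \<open>The vector \<open>v = (n/b) \<Sum>\<^sub>i\<^sub>\<in>\<^sub>B e\<^sub>i\<close> of \<open>\<real>\<^sup>n\<close> is represented by its coordinate function.\<close>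

definition sampling_vector :: "nat \<Rightarrow> nat \<Rightarrow> nat set \<Rightarrow> nat \<Rightarrow> real" where
  "sampling_vector n b B i = (if i \<in> B then real n / real b else 0)"

definition nice_sampling :: "nat \<Rightarrow> nat \<Rightarrow> (nat \<Rightarrow> real) pmf" where
  "nice_sampling n b =
     map_pmf (sampling_vector n b) (pmf_of_set {B. B \<subseteq> {1..n} \<and> card B = b})"

text \<open>One iteration of L-SVRG-D, as a Markov kernel on triples: iterate \<open>x\<close>, reference
  point \<open>w\<close>, current step size \<open>a\<close>. On a successful coin toss the new reference point is the
  iterate before the update.\<close>

definition lsvrgd_step ::
  "nat \<Rightarrow> (nat \<Rightarrow> 'a::euclidean_space \<Rightarrow> real) \<Rightarrow> nat \<Rightarrow> real \<Rightarrow> real \<Rightarrow>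
   'a \<times> 'a \<times> real \<Rightarrow> ('a \<times> 'a \<times> real) pmf" where
  "lsvrgd_step n f b p \<alpha> = (\<lambda>(x, w, a).
     bind_pmf (nice_sampling n b) (\<lambda>v.
     bind_pmf (bernoulli_pmf p) (\<lambda>coin.
       let g = grad (f_sub n f v) x - grad (f_sub n f v) w + grad (f_avg n f) w;
           x' = x - a *\<^sub>R g
       in return_pmf (if coin then (x', x, \<alpha>) else (x', w, sqrt (1 - p) * a)))))"

text \<open>The joint law of \<open>(x\<^sup>k, w\<^sup>k, \<alpha>\<^sub>k)\<close>.\<close>

primrec lsvrgd ::
  "nat \<Rightarrow> (nat \<Rightarrow> 'a::euclidean_space \<Rightarrow> real) \<Rightarrow> nat \<Rightarrow> real \<Rightarrow> real \<Rightarrow> 'a \<Rightarrow> nat \<Rightarrow>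
   ('a \<times> 'a \<times> real) pmf" where
  "lsvrgd n f b p \<alpha> x0 0 = return_pmf (x0, x0, \<alpha>)"
| "lsvrgd n f b p \<alpha> x0 (Suc k) = bind_pmf (lsvrgd n f b p \<alpha> x0 k) (lsvrgd_step n f b p \<alpha>)"

definition exp_smooth :: "nat \<Rightarrow> real \<Rightarrow> real \<Rightarrow> nat \<Rightarrow> real" where
  "exp_smooth n Lmax L b =
     1 / real b * ((real n - real b) / (real n - 1)) * Lmax
     + real n / real b * ((real b - 1) / (real n - 1)) * L"

definition zeta_p :: "real \<Rightarrow> real" where
  "zeta_p p = (7 - 4 * p) * (1 - (1 - p) powr (3 / 2)) / (p * (2 - p) * (3 - 2 * p))"

text \<open>Expected number of evaluations of individual gradients in one iteration.\<close>

definition iteration_cost :: "nat \<Rightarrow> nat \<Rightarrow> real \<Rightarrow> real" where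
  "iteration_cost n b p = 2 * real b + p * real n"

definition total_complexity ::
  "nat \<Rightarrow> real \<Rightarrow> real \<Rightarrow> real \<Rightarrow> real \<Rightarrow> nat \<Rightarrow> real \<Rightarrow> real" where
  "total_complexity n Lmax L \<mu> p b \<epsilon> =
     2 * iteration_cost n b p
       * max (3 * zeta_p p / 2 * (exp_smooth n Lmax L b / \<mu>)) (1 / p) * ln (1 / \<epsilon>)"

end

theory Submission
  imports Defs
begin

text \<open>Write \<open>u = sqrt (1 - p)\<close> and let \<open>D\<close> be the gap \<open>f - f(x\<^sup>*)\<close>. After \<open>j\<close> failed coin tosses the step size
  is \<open>a = \<alpha> s\<close> with \<open>s = u\<^sup>j\<close>. One step gives
  \<open>E |x' - x\<^sup>*|\<^sup>2 \<le> (1 - a\<mu>) |x - x\<^sup>*|\<^sup>2 - 2a D(x) + a\<^sup>2 E |g|\<^sup>2\<close>, where the last term is noise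
  of order \<open>a\<^sup>2 (D(x) + D(w))\<close>.
  A successful toss moves the reference point, so it costs a fixed multiple of \<open>D(x)\<close> with probability
  \<open>p\<close>, whatever the step size is, whereas the gain \<open>2a D(x)\<close> and the contraction \<open>1 - a\<mu>\<close> fade as
  the step size decreases. The balance holds on average over the step size, but step size and
  iterate are correlated, so that neither \<open>a\<close> can be replaced by its mean nor does
  \<open>|x - x\<^sup>*|\<^sup>2 + const a\<^sup>2 D(w)\<close> decrease from each state. The proof uses a larger Lyapunov function that
  decreases from every state by the factor \<open>\<rho> = 1 - \<delta>\<close> with \<open>\<delta> = min (2\<alpha>\<mu>/3) (p/2)\<close>, and that
  is at most \<open>\<phi>\<^sup>0\<close> at the start. It has four terms.

  \<^item> The weight of \<open>|x - x\<^sup>*|\<^sup>2\<close> increases while the step size decreases, in anticipation of the faster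
    contraction after the next reset (\<open>h_contraction\<close>).

  \<^item> A multiple of \<open>|x - w|\<^sup>2\<close> is added. The second moment of the estimator is bounded by
    \<open>2\<Lambda> (D(w) + \<nabla>f(x) \<bullet> (x - w))\<close> with \<open>\<Lambda>\<close> the expected smoothness constant
    (\<open>estimator_second_moment\<close>), and the drift of \<open>|x - w|\<^sup>2\<close> cancels the inner product.

  \<^item> The gap \<open>D(w)\<close> has a weight of order \<open>a\<^sup>2\<close>, which pays for the noise (\<open>c_recursion\<close>).

  \<^item> The last term is a multiple of the discounted sum of the gaps that the trajectory would have if it were
    never reset. Gradient descent with decreasing steps, compared with its own starting point,
    shows that this sum is bounded by the present gap and the noise (\<open>tail_le\<close>). Its weight is zero
    after a reset and grows as the step size shrinks, so that the large gains of early steps pay for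
    the resets of late ones (\<open>potential_step\<close>).

  What remains are inequalities in \<open>u\<close>, \<open>s\<close> and \<open>\<gamma> = 2\<delta>/p\<close>. They are arranged to be affine in \<open>\<gamma>\<close>
  and to be affine or convex quadratic in \<open>s\<close>, which reduces them to polynomials in \<open>u\<close> on the unit interval;
  these are written in the Bernstein basis, where all coefficients are nonnegative.\<close>

section \<open>Gradients of smooth and convex functions\<close>

lemma GDERIV_unique:
  assumes "GDERIV h x :> D" "GDERIV h x :> E"
  shows "D = E"
proof -
  have "(\<lambda>v. v \<bullet> D) = (\<lambda>v. v \<bullet> E)"
    using assms unfolding gderiv_def by (rule has_derivative_unique)
  then have "(D - E) \<bullet> (D - E) = 0"
    by (auto simp: fun_eq_iff inner_diff_right)
  then show ?thesis by simp
qed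

lemma grad_eqI: "GDERIV h x :> D \<Longrightarrow> grad h x = D"
  unfolding grad_def by (blast intro: GDERIV_unique)

text \<open>A derivative on a Euclidean space is the inner product with the adjoint applied to \<open>1\<close>.\<close>

lemma GDERIV_grad:
  assumes "h differentiable (at x)"
  shows "GDERIV h x :> grad h x"
proof -
  obtain h' where h': "(h has_derivative h') (at x)"
    using assms by (auto simp: differentiable_def)
  have "h' = (\<lambda>v. v \<bullet> adjoint h' 1)"
    using adjoint_works[OF has_derivative_linear[OF h'], of _ 1] by auto
  then have "GDERIV h x :> adjoint h' 1"
    using h' by (simp add: gderiv_def)
  then show ?thesis using grad_eqI by metis
qed

text \<open>Difference quotients of a convex function along the segment from \<open>x\<close> to \<open>y\<close> stay below
  the full increment, hence so does their limit.\<close>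

lemma convex_ge_tangent:
  assumes "convex_on UNIV h" "GDERIV h x :> D"
  shows "h x + D \<bullet> (y - x) \<le> h y"
proof -
  define g where "g t = h (x + t *\<^sub>R (y - x))" for t
  have "(h has_derivative (\<lambda>v. v \<bullet> D)) (at (x + 0 *\<^sub>R (y - x)))"
    using assms(2) by (simp add: gderiv_def)
  then have "(g has_derivative (\<lambda>t. (t *\<^sub>R (y - x)) \<bullet> D)) (at 0)"
    unfolding g_def by (rule has_derivative_compose[rotated]) (auto intro!: derivative_eq_intros)
  then have "(g has_real_derivative D \<bullet> (y - x)) (at 0)"
    by (simp add: has_field_derivative_def inner_commute mult.commute[of "_ \<bullet> _"] cong: if_cong)
       (simp add: mult_commute_abs)
  then have "((\<lambda>t. (g t - g 0) / t) \<longlongrightarrow> D \<bullet> (y - x)) (at 0)"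
    by (simp add: has_field_derivative_iff)
  then have lim: "((\<lambda>t. (g t - g 0) / t) \<longlongrightarrow> D \<bullet> (y - x)) (at_right 0)"
    by (rule filterlim_mono) (auto simp: at_le)
  have "\<forall>\<^sub>F t in at_right 0. (g t - g 0) / t \<le> h y - h x"
  proof -
    have "(g t - g 0) / t \<le> h y - h x" if "0 < t" "t < 1" for t
    proof -
      have "h ((1 - t) *\<^sub>R x + t *\<^sub>R y) \<le> (1 - t) * h x + t * h y"
        using that by (intro convex_onD[OF assms(1)]) auto
      moreover have "(1 - t) *\<^sub>R x + t *\<^sub>R y = x + t *\<^sub>R (y - x)"
        by (simp add: algebra_simps)
      ultimately show ?thesis using that by (simp add: g_def field_simps)
    qed
    then show ?thesis unfolding eventually_at_right_field by (intro exI[of _ 1]) auto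
  qed
  then have "D \<bullet> (y - x) \<le> h y - h x"
    by (intro tendsto_upperbound[OF lim]) auto
  then show ?thesis by simp
qed

lemma smooth_convex_nonneg:
  fixes h :: "'a::euclidean_space \<Rightarrow> real"
  assumes "convex_on UNIV h" "\<And>x. h differentiable (at x)" "smooth_with L h"
  shows "0 \<le> L"
proof -
  obtain e :: 'a where e: "e \<in> Basis" using nonempty_Basis by blast
  have "h 0 + grad h 0 \<bullet> (e - 0) \<le> h 0 + grad h 0 \<bullet> (e - 0) + L / 2 * (norm (e - 0))\<^sup>2"
    using convex_ge_tangent[OF assms(1) GDERIV_grad[OF assms(2)], of 0 e] assms(3)
    unfolding smooth_with_def by (meson order_trans)
  then show ?thesis using e by simp
qed

text \<open>Go from \<open>x\<close> against the difference of the two gradients: the quadratic upper bound at \<open>x\<close>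
  and the tangent at \<open>y\<close> must leave room for each other at the new point, and the best step
  length \<open>1/L\<close> gives the estimate. For \<open>L = 0\<close> arbitrarily long steps force equal gradients.\<close>

lemma smooth_convex_cocoercive:
  fixes h :: "'a::euclidean_space \<Rightarrow> real"
  assumes "convex_on UNIV h" "\<And>x. h differentiable (at x)" "smooth_with L h"
  shows "(norm (grad h x - grad h y))\<^sup>2 \<le> 2 * L * (h x - h y - grad h y \<bullet> (x - y))"
proof -
  define d where "d = grad h x - grad h y"
  define B where "B = h x - h y - grad h y \<bullet> (x - y)"
  have key: "t * (norm d)\<^sup>2 - L / 2 * (t\<^sup>2 * (norm d)\<^sup>2) \<le> B" for t
  proof -
    let ?z = "x - t *\<^sub>R d"
    have "h y + grad h y \<bullet> (?z - y) \<le> h ?z"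
      by (rule convex_ge_tangent[OF assms(1) GDERIV_grad[OF assms(2)]])
    moreover have "h ?z \<le> h x + grad h x \<bullet> (?z - x) + L / 2 * (norm (?z - x))\<^sup>2"
      using assms(3) unfolding smooth_with_def by blast
    moreover have "grad h y \<bullet> (?z - y) - grad h x \<bullet> (?z - x) = grad h y \<bullet> (x - y) + t * (norm d)\<^sup>2"
      by (simp add: d_def power2_norm_eq_inner algebra_simps inner_diff_left inner_diff_right)
    moreover have "(norm (?z - x))\<^sup>2 = t\<^sup>2 * (norm d)\<^sup>2" by (simp add: power_mult_distrib)
    ultimately show ?thesis by (simp add: B_def)
  qed
  have "0 \<le> L" by (rule smooth_convex_nonneg[OF assms])
  show ?thesis
  proof (cases "L = 0")
    case True
    have "d = 0"
    proof (rule ccontr)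
      assume "d \<noteq> 0"
      then show False using key[of "(B + 1) / (norm d)\<^sup>2"] True by simp
    qed
    then show ?thesis using True by (simp add: d_def)
  next
    case False
    then have "0 < L" using \<open>0 \<le> L\<close> by simp
    have "(norm d)\<^sup>2 / (2 * L) \<le> B"
      using key[of "1 / L"] \<open>0 < L\<close> by (simp add: field_simps power2_eq_square)
    then show ?thesis using \<open>0 < L\<close> by (simp add: d_def B_def field_simps)
  qed
qed

lemma GDERIV_weighted_sum:
  assumes "\<And>i. i \<in> I \<Longrightarrow> GDERIV (f i) x :> d i"
  shows "GDERIV (\<lambda>x. \<Sum>i\<in>I. c i * f i x) x :> (\<Sum>i\<in>I. c i *\<^sub>R d i)"
proof -
  have "((\<lambda>x. \<Sum>i\<in>I. c i * f i x) has_derivative (\<lambda>v. \<Sum>i\<in>I. c i * (v \<bullet> d i))) (at x)"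
    using assms by (intro has_derivative_sum has_derivative_mult_right) (simp add: gderiv_def)
  then show ?thesis by (simp add: gderiv_def inner_sum_right)
qed

lemma smooth_ge_growth:
  fixes h :: "'a::euclidean_space \<Rightarrow> real"
  assumes "smooth_with L h" "strongly_convex_with \<mu> h"
  shows "\<mu> \<le> L"
proof -
  obtain e :: 'a where e: "e \<in> Basis" using nonempty_Basis by blast
  have "h e \<le> h 0 + grad h 0 \<bullet> (e - 0) + L / 2 * (norm (e - 0))\<^sup>2"
    using assms(1) unfolding smooth_with_def by blast
  moreover have "h 0 \<le> h e + grad h 0 \<bullet> (0 - e) - \<mu> / 2 * (norm (0 - e))\<^sup>2"
    using assms(2) unfolding strongly_convex_with_def by blast
  ultimately show ?thesis using e by simp
qed

text \<open>The gradient at the other end of the segment bounds the Bregman divergence by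
  \<open>d \<bullet> v - (\<mu>/2) |v|\<^sup>2\<close>, and completing the square removes \<open>v = w - x\<close>.\<close>

lemma strongly_convex_bregman_le:
  fixes h :: "'a::euclidean_space \<Rightarrow> real"
  assumes "strongly_convex_with \<mu> h" "0 \<le> \<mu>"
  shows "2 * \<mu> * (h w - h x - grad h x \<bullet> (w - x)) \<le> (norm (grad h x - grad h w))\<^sup>2"
proof -
  let ?d = "grad h w - grad h x"
  have "h w \<le> h x + grad h w \<bullet> (w - x) - \<mu> / 2 * (norm (w - x))\<^sup>2"
    using assms(1) unfolding strongly_convex_with_def by blast
  then have "2 * \<mu> * (h w - h x - grad h x \<bullet> (w - x)) \<le> 2 * \<mu> * (?d \<bullet> (w - x) - \<mu> / 2 * (norm (w - x))\<^sup>2)"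
    using assms(2) by (intro mult_left_mono) (auto simp: inner_diff_left)
  also have "\<dots> = (norm ?d)\<^sup>2 - (norm (?d - \<mu> *\<^sub>R (w - x)))\<^sup>2"
    unfolding power2_norm_eq_inner
    by (simp add: inner_diff_left inner_diff_right inner_commute algebra_simps power2_eq_square)
  also have "\<dots> \<le> (norm ?d)\<^sup>2" by simp
  finally show ?thesis by (simp add: norm_minus_commute)
qed

lemma strongly_convex_mono:
  fixes h :: "'a::euclidean_space \<Rightarrow> real"
  assumes "strongly_convex_with \<mu> h" "\<mu>' \<le> \<mu>"
  shows "strongly_convex_with \<mu>' h"
  unfolding strongly_convex_with_def
proof (intro allI)
  fix x y :: 'a
  have "\<mu>' / 2 * (norm (x - y))\<^sup>2 \<le> \<mu> / 2 * (norm (x - y))\<^sup>2"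
    using assms(2) by (intro mult_right_mono) auto
  moreover have "h x \<le> h y + grad h x \<bullet> (x - y) - \<mu> / 2 * (norm (x - y))\<^sup>2"
    using assms(1) unfolding strongly_convex_with_def by blast
  ultimately show "h x \<le> h y + grad h x \<bullet> (x - y) - \<mu>' / 2 * (norm (x - y))\<^sup>2" by linarith
qed

lemma convex_on_sum_functions:
  assumes "finite I" "\<And>i. i \<in> I \<Longrightarrow> convex_on UNIV (f i)"
  shows "convex_on UNIV (\<lambda>x. \<Sum>i\<in>I. f i x)"
  using assms
proof (induction I rule: finite_induct)
  case empty
  then show ?case by (simp add: convex_on_const)
next
  case (insert i I)
  then show ?case by (simp add: convex_on_add)
qed

section \<open>Averages over all batches of a given size\<close>

text \<open>The sampling is uniform on finitely many batches, so expectations over one draw are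
  treated as plain averages.\<close>

definition batches :: "nat \<Rightarrow> nat \<Rightarrow> nat set set" where
  "batches n b = {B. B \<subseteq> {1..n} \<and> card B = b}"

definition batch_mean :: "nat \<Rightarrow> nat \<Rightarrow> (nat set \<Rightarrow> 'a::real_vector) \<Rightarrow> 'a" where
  "batch_mean n b \<phi> = (\<Sum>B\<in>batches n b. \<phi> B) /\<^sub>R real (card (batches n b))"

lemma finite_batches: "finite (batches n b)"
  by (simp add: batches_def)

lemma card_batches: "card (batches n b) = n choose b"
  using n_subsets[of "{1..n}" b] by (simp add: batches_def)

lemma card_batches_containing:
  assumes "S \<subseteq> {1..n}"
  shows "card {B \<in> batches n (b + card S). S \<subseteq> B} = (n - card S) choose b"
proof -
  have fin: "finite S" using assms finite_subset by blast
  have "bij_betw (\<lambda>B. B - S) {B \<in> batches n (b + card S). S \<subseteq> B}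
      {B. B \<subseteq> {1..n} - S \<and> card B = b}"
  proof (rule bij_betw_byWitness[where f' = "\<lambda>B. B \<union> S"])
    show "(\<lambda>B. B - S) ` {B \<in> batches n (b + card S). S \<subseteq> B} \<subseteq> {B. B \<subseteq> {1..n} - S \<and> card B = b}"
      using fin by (auto simp: batches_def card_Diff_subset)
    show "(\<lambda>B. B \<union> S) ` {B. B \<subseteq> {1..n} - S \<and> card B = b} \<subseteq> {B \<in> batches n (b + card S). S \<subseteq> B}"
    proof -
      have "card (B \<union> S) = card B + card S" if "B \<subseteq> {1..n} - S" for B
        using that fin finite_subset[OF that] by (intro card_Un_disjoint) auto
      then show ?thesis using assms by (auto simp: batches_def)
    qed
  qed auto
  then show ?thesis
    using n_subsets[of "{1..n} - S" b] assms fin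
    by (simp add: bij_betw_same_card card_Diff_subset)
qed

lemma card_batches_pos: "b \<le> n \<Longrightarrow> 0 < card (batches n b)"
  by (simp add: card_batches)

lemma card_batches_one:
  assumes "i \<in> {1..n}" "b \<in> {1..n}"
  shows "real (card {B \<in> batches n b. i \<in> B}) = real b / real n * real (card (batches n b))"
proof -
  obtain c m where c: "b = Suc c" "n = Suc m" using assms by (cases b; cases n) auto
  have "Suc c * (Suc m choose Suc c) = Suc m * (m choose c)"
    using Suc_times_binomial[of c m] by simp
  then have "real (m choose c) = real (Suc c) / real (Suc m) * real (Suc m choose Suc c)"
    by (metis nonzero_mult_div_cancel_left of_nat_0_neq of_nat_mult times_divide_eq_left)
  then show ?thesis
    using card_batches_containing[of "{i}" n c] assms(1) c by (simp add: card_batches)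
qed

lemma card_batches_two:
  assumes "i \<in> {1..n}" "j \<in> {1..n}" "i \<noteq> j" "b \<in> {1..n}"
  shows "real (card {B \<in> batches n b. i \<in> B \<and> j \<in> B})
    = real b * (real b - 1) / (real n * (real n - 1)) * real (card (batches n b))"
proof (cases "b = 1")
  case True
  have "{B \<in> batches n b. i \<in> B \<and> j \<in> B} = {}"
    using assms(3) True by (auto simp: batches_def card_1_singleton_iff)
  then show ?thesis using True by (simp only: card.empty) simp
next
  case False
  obtain c m where c: "b = Suc (Suc c)" "n = Suc (Suc m)"
    using assms False by (cases b; cases "b - 1"; cases n; cases "n - 1") auto
  have 1: "real (Suc (Suc c)) * real (Suc (Suc m) choose Suc (Suc c)) = real (Suc (Suc m)) * real (Suc m choose Suc c)"
    using Suc_times_binomial[of "Suc c" "Suc m"] by (metis of_nat_mult)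
  have 2: "real (Suc c) * real (Suc m choose Suc c) = real (Suc m) * real (m choose c)"
    using Suc_times_binomial[of c m] by (metis of_nat_mult)
  define N where "N = real (Suc (Suc m) choose Suc (Suc c))"
  define N1 where "N1 = real (Suc m choose Suc c)"
  have "N1 = real b * N / real n" using 1 by (simp add: c N_def N1_def field_simps)
  then have "real (m choose c) = real (Suc c) * (real b * N / real n) / real (Suc m)"
    using 2 unfolding N1_def[symmetric] by (simp add: field_simps)
  moreover have "real (Suc c) = real b - 1" "real (Suc m) = real n - 1" by (auto simp: c)
  ultimately have "real (m choose c) = (real b - 1) * (real b * N / real n) / (real n - 1)"
    by (simp only:)
  then have "real (m choose c) = real b * (real b - 1) / (real n * (real n - 1)) * N"
    by (simp add: mult_ac)
  then show ?thesis
    using card_batches_containing[of "{i, j}" n c] assms c by (simp add: card_batches N_def)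
qed

lemma batch_mean_add: "batch_mean n b (\<lambda>B. \<phi> B + \<psi> B) = batch_mean n b \<phi> + batch_mean n b \<psi>"
  by (simp add: batch_mean_def sum.distrib scaleR_add_right)

lemma batch_mean_diff: "batch_mean n b (\<lambda>B. \<phi> B - \<psi> B) = batch_mean n b \<phi> - batch_mean n b \<psi>"
  by (simp add: batch_mean_def sum_subtractf scaleR_diff_right)

lemma batch_mean_const:
  assumes "b \<le> n"
  shows "batch_mean n b (\<lambda>B. c) = c"
  using card_batches_pos[OF assms] by (simp add: batch_mean_def sum_constant_scaleR)

lemma batch_mean_cmult: "batch_mean n b (\<lambda>B. c * \<phi> B) = c * batch_mean n b \<phi>" for c :: real
  by (simp add: batch_mean_def sum_distrib_left[symmetric])

lemma batch_mean_inner: "batch_mean n b (\<lambda>B. c \<bullet> \<phi> B) = c \<bullet> batch_mean n b \<phi>"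
  by (simp add: batch_mean_def inner_sum_right)

lemma batch_mean_mono:
  fixes \<phi> \<psi> :: "nat set \<Rightarrow> real"
  assumes "\<And>B. \<phi> B \<le> \<psi> B"
  shows "batch_mean n b \<phi> \<le> batch_mean n b \<psi>"
  unfolding batch_mean_def by (intro scaleR_left_mono sum_mono assms) auto

lemma sum_batches_swap:
  "(\<Sum>B\<in>batches n b. \<Sum>i\<in>B. z i) = (\<Sum>i=1..n. real (card {B \<in> batches n b. i \<in> B}) *\<^sub>R z i)"
  for z :: "nat \<Rightarrow> 'a::real_vector"
proof -
  have "(\<Sum>B\<in>batches n b. \<Sum>i\<in>B. z i) = (\<Sum>B\<in>batches n b. \<Sum>i\<in>{i\<in>{1..n}. i \<in> B}. z i)"
    by (intro sum.cong refl) (auto simp: batches_def intro: arg_cong2[where f = sum])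
  also have "\<dots> = (\<Sum>i=1..n. \<Sum>B\<in>{B \<in> batches n b. i \<in> B}. z i)"
    by (rule sum.swap_restrict) (auto simp: finite_batches)
  finally show ?thesis by (simp add: sum_constant_scaleR)
qed

lemma batch_mean_of_means:
  fixes z :: "nat \<Rightarrow> 'a::real_vector"
  assumes "b \<in> {1..n}"
  shows "batch_mean n b (\<lambda>B. (\<Sum>i\<in>B. z i) /\<^sub>R real b) = (\<Sum>i=1..n. z i) /\<^sub>R real n"
proof -
  have "(\<Sum>B\<in>batches n b. \<Sum>i\<in>B. z i) = (\<Sum>i=1..n. (real b / real n * real (card (batches n b))) *\<^sub>R z i)"
    unfolding sum_batches_swap using card_batches_one[OF _ assms] by (intro sum.cong) auto
  also have "\<dots> = (real b / real n * real (card (batches n b))) *\<^sub>R (\<Sum>i=1..n. z i)"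
    by (simp add: scaleR_sum_right)
  finally show ?thesis
    using assms card_batches_pos[of b n] unfolding batch_mean_def scaleR_sum_right[symmetric]
    by (simp add: field_simps)
qed

text \<open>Expand the square into pairs \<open>(i, j)\<close>. A batch contains a given index with frequency \<open>b/n\<close>
  and a given pair of distinct indices with frequency \<open>b(b-1)/(n(n-1))\<close>, so the diagonal keeps
  a separate weight. These are the two weights in the definition of \<open>exp_smooth\<close>.\<close>

lemma batch_second_moment:
  fixes z :: "nat \<Rightarrow> 'a::real_inner"
  assumes "2 \<le> n" "b \<in> {1..n}"
  shows "batch_mean n b (\<lambda>B. (norm ((\<Sum>i\<in>B. z i) /\<^sub>R real b))\<^sup>2)
    = 1 / real b * ((real n - real b) / (real n - 1)) * ((\<Sum>i=1..n. (norm (z i))\<^sup>2) / real n)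
      + real n / real b * ((real b - 1) / (real n - 1)) * (norm ((\<Sum>i=1..n. z i) /\<^sub>R real n))\<^sup>2"
proof -
  define N where "N = real (card (batches n b))"
  define N1 where "N1 = real b / real n * N"
  define N2 where "N2 = real b * (real b - 1) / (real n * (real n - 1)) * N"
  have N: "0 < N" using assms card_batches_pos[of b n] by (simp add: N_def)
  have nb: "0 < real n" "0 < real n - 1" "0 < real b" using assms by auto
  let ?Q = "\<Sum>i=1..n. (norm (z i))\<^sup>2" and ?Z = "\<Sum>i=1..n. z i"
  have sq: "(norm (\<Sum>i\<in>B. z i))\<^sup>2 = (\<Sum>(i, j)\<in>B \<times> B. z i \<bullet> z j)" for B
    by (simp add: power2_norm_eq_inner inner_sum_left inner_sum_right sum.cartesian_product inner_commute)
  have "(\<Sum>B\<in>batches n b. (norm (\<Sum>i\<in>B. z i))\<^sup>2)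
      = (\<Sum>B\<in>batches n b. \<Sum>x\<in>{x\<in>{1..n} \<times> {1..n}. fst x \<in> B \<and> snd x \<in> B}. z (fst x) \<bullet> z (snd x))"
    unfolding sq by (intro sum.cong refl) (auto simp: batches_def split_beta intro!: sum.cong)
  also have "\<dots> = (\<Sum>x\<in>{1..n} \<times> {1..n}. \<Sum>B\<in>{B \<in> batches n b. fst x \<in> B \<and> snd x \<in> B}. z (fst x) \<bullet> z (snd x))"
    by (rule sum.swap_restrict) (auto simp: finite_batches)
  also have "\<dots> = (\<Sum>x\<in>{1..n} \<times> {1..n}. N2 * (z (fst x) \<bullet> z (snd x))
      + (if fst x = snd x then (N1 - N2) * (norm (z (fst x)))\<^sup>2 else 0))"
  proof (intro sum.cong refl)
    fix x assume x: "x \<in> {1..n} \<times> {1..n}"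
    show "(\<Sum>B\<in>{B \<in> batches n b. fst x \<in> B \<and> snd x \<in> B}. z (fst x) \<bullet> z (snd x))
      = N2 * (z (fst x) \<bullet> z (snd x)) + (if fst x = snd x then (N1 - N2) * (norm (z (fst x)))\<^sup>2 else 0)"
    proof (cases "fst x = snd x")
      case True
      have "real (card {B \<in> batches n b. fst x \<in> B}) = N1"
        using card_batches_one[of "fst x" n b] x assms by (auto simp: N1_def N_def)
      then show ?thesis using True by (simp add: power2_norm_eq_inner algebra_simps)
    next
      case False
      have "real (card {B \<in> batches n b. fst x \<in> B \<and> snd x \<in> B}) = N2"
        unfolding N2_def N_def using x False by (intro card_batches_two assms) auto
      then show ?thesis using False by simp
    qed
  qed
  also have "\<dots> = N2 * (norm ?Z)\<^sup>2 + (N1 - N2) * ?Q"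
  proof -
    have "(\<Sum>x\<in>{1..n} \<times> {1..n}. if fst x = snd x then (N1 - N2) * (norm (z (fst x)))\<^sup>2 else 0)
        = (\<Sum>i=1..n. \<Sum>j=1..n. if i = j then (N1 - N2) * (norm (z i))\<^sup>2 else 0)"
      unfolding sum.cartesian_product by (intro sum.cong refl) auto
    also have "\<dots> = (N1 - N2) * ?Q"
      by (simp add: sum_distrib_left)
    finally show ?thesis
      by (simp add: sum.distrib sq split_beta sum_distrib_left)
  qed
  finally have total: "(\<Sum>B\<in>batches n b. (norm (\<Sum>i\<in>B. z i))\<^sup>2) = N2 * (norm ?Z)\<^sup>2 + (N1 - N2) * ?Q" .
  have "batch_mean n b (\<lambda>B. (norm ((\<Sum>i\<in>B. z i) /\<^sub>R real b))\<^sup>2)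
      = (\<Sum>B\<in>batches n b. (norm (\<Sum>i\<in>B. z i))\<^sup>2 / (real b)\<^sup>2) / N"
    by (simp add: batch_mean_def N_def power_mult_distrib power_inverse divide_inverse mult_ac)
  also have "\<dots> = (N2 * (norm ?Z)\<^sup>2 + (N1 - N2) * ?Q) / (N * (real b)\<^sup>2)"
    by (simp add: sum_divide_distrib[symmetric] total mult.commute)
  also have "\<dots> = N2 / (N * (real b)\<^sup>2) * (norm ?Z)\<^sup>2 + (N1 - N2) / (N * (real b)\<^sup>2) * ?Q"
    by (simp add: add_divide_distrib)
  also have "N2 / (N * (real b)\<^sup>2) = real n / real b * ((real b - 1) / (real n - 1)) / (real n)\<^sup>2"
    using N nb by (simp add: N2_def field_simps power2_eq_square)
  also have "(N1 - N2) / (N * (real b)\<^sup>2) = 1 / real b * ((real n - real b) / (real n - 1)) / real n"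
  proof -
    have "N1 - N2 = N * (real b / real n) * (1 - (real b - 1) / (real n - 1))"
      by (simp add: N1_def N2_def algebra_simps)
    also have "1 - (real b - 1) / (real n - 1) = (real n - real b) / (real n - 1)"
      using nb by (simp add: field_simps)
    finally show ?thesis using N nb by (simp add: power2_eq_square)
  qed
  finally show ?thesis
    by (simp add: power_mult_distrib power_divide divide_inverse power_inverse mult_ac)
qed

section \<open>The finite-sum problem and its gradient estimator\<close>

locale finite_sum_problem =
  fixes f :: "nat \<Rightarrow> 'a::euclidean_space \<Rightarrow> real"
    and Ls :: "nat \<Rightarrow> real" and L \<mu> Lmax :: real and n b :: nat and xs :: 'a
  assumes n_ge: "2 \<le> n"
    and diff: "i \<in> {1..n} \<Longrightarrow> f i differentiable (at x)"
    and convex: "i \<in> {1..n} \<Longrightarrow> convex_on UNIV (f i)"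
    and smooth: "i \<in> {1..n} \<Longrightarrow> smooth_with (Ls i) (f i)"
    and Lmax: "Lmax = Max (Ls ` {1..n})"
    and smooth_F: "smooth_with L (f_avg n f)"
    and mu_pos: "0 < \<mu>" and strong_F: "strongly_convex_with \<mu> (f_avg n f)"
    and minimizer: "f_avg n f xs \<le> f_avg n f x"
    and b_in: "b \<in> {1..n}"
begin

abbreviation "F \<equiv> f_avg n f"
abbreviation "\<Lambda> \<equiv> exp_smooth n Lmax L b"

definition estimator :: "nat set \<Rightarrow> 'a \<Rightarrow> 'a \<Rightarrow> 'a" where
  "estimator B x w = (\<Sum>i\<in>B. grad (f i) x - grad (f i) w) /\<^sub>R real b + grad F w"

lemma b_le: "b \<le> n" using b_in by simp

lemma GDERIV_F: "GDERIV F x :> (\<Sum>i=1..n. grad (f i) x) /\<^sub>R real n"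
proof -
  have "GDERIV (\<lambda>x. \<Sum>i=1..n. (1 / real n) * f i x) x :> (\<Sum>i=1..n. (1 / real n) *\<^sub>R grad (f i) x)"
    using diff by (intro GDERIV_weighted_sum GDERIV_grad) auto
  then show ?thesis
    unfolding f_avg_def sum_distrib_left by (simp add: scaleR_sum_right divide_inverse)
qed

lemma grad_F: "grad F x = (\<Sum>i=1..n. grad (f i) x) /\<^sub>R real n"
  by (rule grad_eqI[OF GDERIV_F])

lemma diff_F: "F differentiable (at x)"
  using GDERIV_F[of x] unfolding gderiv_def differentiable_def by blast

lemma convex_F: "convex_on UNIV F"
proof -
  have "convex_on UNIV (\<lambda>x. 1 / real n * (\<Sum>i=1..n. f i x))"
    using convex by (intro convex_on_cmul convex_on_sum_functions) auto
  then show ?thesis by (simp add: f_avg_def[abs_def])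
qed

lemma grad_f_sub:
  assumes "B \<in> batches n b"
  shows "grad (f_sub n f (sampling_vector n b B)) x = (\<Sum>i\<in>B. grad (f i) x) /\<^sub>R real b"
proof -
  let ?v = "sampling_vector n b B"
  have B: "B \<subseteq> {1..n}" using assms by (simp add: batches_def)
  have "GDERIV (\<lambda>x. \<Sum>i=1..n. (1 / real n * ?v i) * f i x) x :> (\<Sum>i=1..n. (1 / real n * ?v i) *\<^sub>R grad (f i) x)"
    using diff by (intro GDERIV_weighted_sum GDERIV_grad) auto
  moreover have "(\<lambda>x. \<Sum>i=1..n. (1 / real n * ?v i) * f i x) = f_sub n f ?v"
    by (simp add: f_sub_def fun_eq_iff sum_distrib_left mult.assoc)
  moreover have "(\<Sum>i=1..n. (1 / real n * ?v i) *\<^sub>R grad (f i) x) = (\<Sum>i\<in>B. grad (f i) x) /\<^sub>R real b"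
  proof -
    have "(\<Sum>i=1..n. (1 / real n * ?v i) *\<^sub>R grad (f i) x)
        = (\<Sum>i=1..n. if i \<in> B then grad (f i) x /\<^sub>R real b else 0)"
      using n_ge by (intro sum.cong refl) (auto simp: sampling_vector_def divide_inverse)
    also have "\<dots> = (\<Sum>i\<in>B. grad (f i) x /\<^sub>R real b)"
      using B by (simp add: sum.If_cases Int_absorb1)
    finally show ?thesis by (simp add: scaleR_sum_right)
  qed
  ultimately show ?thesis by (simp add: grad_eqI)
qed

lemma Ls_le: "i \<in> {1..n} \<Longrightarrow> Ls i \<le> Lmax"
  unfolding Lmax by (intro Max_ge) auto

lemma smooth_F_Lmax: "smooth_with Lmax F"
  unfolding smooth_with_def
proof (intro allI)
  fix x y :: 'a
  have "(\<Sum>i=1..n. f i x) \<le> (\<Sum>i=1..n. f i y + grad (f i) y \<bullet> (x - y) + Lmax / 2 * (norm (x - y))\<^sup>2)"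
  proof (rule sum_mono)
    fix i assume i: "i \<in> {1..n}"
    have "f i x \<le> f i y + grad (f i) y \<bullet> (x - y) + Ls i / 2 * (norm (x - y))\<^sup>2"
      using smooth[OF i] unfolding smooth_with_def by blast
    moreover have "Ls i / 2 * (norm (x - y))\<^sup>2 \<le> Lmax / 2 * (norm (x - y))\<^sup>2"
      using Ls_le[OF i] by (intro mult_right_mono) auto
    ultimately show "f i x \<le> f i y + grad (f i) y \<bullet> (x - y) + Lmax / 2 * (norm (x - y))\<^sup>2" by linarith
  qed
  also have "\<dots> = (\<Sum>i=1..n. f i y) + (\<Sum>i=1..n. grad (f i) y) \<bullet> (x - y)
      + real n * (Lmax / 2 * (norm (x - y))\<^sup>2)"
    by (simp add: sum.distrib inner_sum_left)
  finally have "1 / real n * (\<Sum>i=1..n. f i x)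
      \<le> 1 / real n * ((\<Sum>i=1..n. f i y) + (\<Sum>i=1..n. grad (f i) y) \<bullet> (x - y)
        + real n * (Lmax / 2 * (norm (x - y))\<^sup>2))"
    by (intro mult_left_mono) auto
  also have "\<dots> = F y + grad F y \<bullet> (x - y) + Lmax / 2 * (norm (x - y))\<^sup>2"
    using n_ge by (simp only: distrib_left f_avg_def grad_F inner_scaleR_left inverse_eq_divide) simp
  finally show "F x \<le> F y + grad F y \<bullet> (x - y) + Lmax / 2 * (norm (x - y))\<^sup>2"
    by (simp add: f_avg_def)
qed

text \<open>The expected smoothness constant is the convex combination of \<open>Lmax\<close> and \<open>L\<close> with these
  weights. Both are smoothness constants of the average, so an inequality that is linear in the
  constant and holds for every smoothness constant of the average holds for \<open>\<Lambda>\<close> as well.\<close>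

definition "w1 = 1 / real b * ((real n - real b) / (real n - 1))"
definition "w2 = real n / real b * ((real b - 1) / (real n - 1))"

lemma weights: "0 \<le> w1" "0 \<le> w2" "w1 + w2 = 1"
proof -
  show "0 \<le> w1" "0 \<le> w2" using n_ge b_in by (auto simp: w1_def w2_def)
  have "w1 + w2 = (real n - real b) / (real b * (real n - 1)) + (real n * (real b - 1)) / (real b * (real n - 1))"
    by (simp add: w1_def w2_def)
  also have "\<dots> = (real b * (real n - 1)) / (real b * (real n - 1))"
  proof -
    have "(real n - real b) + real n * (real b - 1) = real b * (real n - 1)" by algebra
    then show ?thesis by (simp only: add_divide_distrib[symmetric])
  qed
  also have "\<dots> = 1" using n_ge b_in by (intro divide_self) auto
  finally show "w1 + w2 = 1" .
qed

lemma exp_smooth_eq: "\<Lambda> = w1 * Lmax + w2 * L"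
  by (simp add: exp_smooth_def w1_def w2_def)

lemma mu_le_exp_smooth: "\<mu> \<le> \<Lambda>"
proof -
  have "w1 * \<mu> + w2 * \<mu> \<le> w1 * Lmax + w2 * L"
    using weights smooth_ge_growth[OF smooth_F_Lmax strong_F] smooth_ge_growth[OF smooth_F strong_F]
    by (intro add_mono mult_left_mono) auto
  then show ?thesis using weights(3) by (simp add: exp_smooth_eq distrib_right[symmetric])
qed

lemma grad_F_minimizer: "grad F xs = 0"
proof -
  have "(F has_derivative (\<lambda>v. v \<bullet> grad F xs)) (at xs)"
    using GDERIV_grad[OF diff_F] by (simp add: gderiv_def)
  then have "(\<lambda>v. v \<bullet> grad F xs) = (\<lambda>v. 0)"
    using minimizer by (intro differential_zero_maxmin[of xs UNIV F]) auto
  then have "grad F xs \<bullet> grad F xs = 0" by meson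
  then show ?thesis by simp
qed

lemma grad_F_sq_le: "(norm (grad F x))\<^sup>2 \<le> 2 * \<Lambda> * (F x - F xs)"
proof -
  have "(norm (grad F x))\<^sup>2 \<le> 2 * K * (F x - F xs)" if "smooth_with K F" for K
    using smooth_convex_cocoercive[OF convex_F diff_F that, of x xs] grad_F_minimizer by simp
  from this[OF smooth_F_Lmax] this[OF smooth_F]
  have "w1 * (norm (grad F x))\<^sup>2 + w2 * (norm (grad F x))\<^sup>2
      \<le> w1 * (2 * Lmax * (F x - F xs)) + w2 * (2 * L * (F x - F xs))"
    using weights by (intro add_mono mult_left_mono) auto
  moreover have "w1 * (norm (grad F x))\<^sup>2 + w2 * (norm (grad F x))\<^sup>2 = (norm (grad F x))\<^sup>2"
    using weights(3) by (simp add: distrib_right[symmetric])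
  ultimately show ?thesis by (simp add: exp_smooth_eq algebra_simps)
qed

lemma estimator_mean: "batch_mean n b (\<lambda>B. estimator B x w) = grad F x"
proof -
  have "batch_mean n b (\<lambda>B. estimator B x w)
      = (\<Sum>i=1..n. grad (f i) x - grad (f i) w) /\<^sub>R real n + grad F w"
    unfolding estimator_def
    by (simp only: batch_mean_add batch_mean_of_means[OF b_in] batch_mean_const[OF b_le])
  then show ?thesis by (simp add: grad_F sum_subtractf scaleR_diff_right)
qed

text \<open>Write \<open>d\<close> for the difference of the full gradients and \<open>Br\<close> for the Bregman divergence of \<open>w\<close>
  from \<open>x\<close>. The second moment is
  \<open>|grad F x|\<^sup>2\<close> plus the second moment of the sampled differences minus \<open>|d|\<^sup>2\<close>, where the middle
  term is at most \<open>2\<Lambda> Br\<close> by cocoercivity. Keeping \<open>Br\<close> instead of splitting the sampled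
  difference at the minimizer by \<open>|a + b|\<^sup>2 \<le> 2|a|\<^sup>2 + 2|b|\<^sup>2\<close> leaves a noise term with an inner product
  that telescopes against \<open>|x - w|\<^sup>2\<close>. Strong convexity gives \<open>2\<mu>' Br \<le> |d|\<^sup>2\<close>; one half of this
  is used, which reduces the noise when \<open>\<mu>\<close> is comparable with \<open>\<Lambda>\<close>.\<close>

lemma estimator_second_moment:
  assumes "0 \<le> \<mu>'" "\<mu>' \<le> \<mu>"
  shows "batch_mean n b (\<lambda>B. (norm (estimator B x w))\<^sup>2)
    \<le> (2 * \<Lambda> - \<mu>') * ((F w - F xs) + grad F x \<bullet> (x - w)) + \<mu>' * (F x - F xs)"
proof -
  define z where "z i = grad (f i) x - grad (f i) w" for i
  define d where "d = grad F x - grad F w"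
  define Br where "Br = F w - F x - grad F x \<bullet> (w - x)"
  have zmean: "(\<Sum>i=1..n. z i) /\<^sub>R real n = d"
    by (simp add: z_def d_def grad_F sum_subtractf scaleR_diff_right)
  have "(norm (estimator B x w))\<^sup>2 = (norm ((\<Sum>i\<in>B. z i) /\<^sub>R real b))\<^sup>2
      + 2 * (grad F w \<bullet> ((\<Sum>i\<in>B. z i) /\<^sub>R real b)) + (norm (grad F w))\<^sup>2" for B
    unfolding power2_norm_eq_inner estimator_def z_def[symmetric]
    by (simp add: inner_add_left inner_add_right inner_commute)
  then have "batch_mean n b (\<lambda>B. (norm (estimator B x w))\<^sup>2)
      = batch_mean n b (\<lambda>B. (norm ((\<Sum>i\<in>B. z i) /\<^sub>R real b))\<^sup>2) + 2 * (grad F w \<bullet> d) + (norm (grad F w))\<^sup>2"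
    by (simp only: batch_mean_add batch_mean_cmult batch_mean_inner batch_mean_const[OF b_le]
        batch_mean_of_means[OF b_in] zmean)
  moreover have "2 * (grad F w \<bullet> d) + (norm (grad F w))\<^sup>2 = (norm (grad F x))\<^sup>2 - (norm d)\<^sup>2"
    unfolding d_def power2_norm_eq_inner by (simp add: inner_diff_left inner_diff_right inner_commute)
  ultimately have 1: "batch_mean n b (\<lambda>B. (norm (estimator B x w))\<^sup>2)
      = batch_mean n b (\<lambda>B. (norm ((\<Sum>i\<in>B. z i) /\<^sub>R real b))\<^sup>2) + (norm (grad F x))\<^sup>2 - (norm d)\<^sup>2" by simp
  have "batch_mean n b (\<lambda>B. (norm ((\<Sum>i\<in>B. z i) /\<^sub>R real b))\<^sup>2)
      = w1 * ((\<Sum>i=1..n. (norm (z i))\<^sup>2) / real n) + w2 * (norm d)\<^sup>2"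
    unfolding batch_second_moment[OF n_ge b_in] zmean w1_def w2_def ..
  also have "\<dots> \<le> w1 * (2 * Lmax * Br) + w2 * (2 * L * Br)"
  proof (intro add_mono mult_left_mono weights)
    have "(norm d)\<^sup>2 = (norm (grad F w - grad F x))\<^sup>2" by (simp add: d_def norm_minus_commute)
    also have "\<dots> \<le> 2 * L * Br"
      unfolding Br_def by (rule smooth_convex_cocoercive[OF convex_F diff_F smooth_F])
    finally show "(norm d)\<^sup>2 \<le> 2 * L * Br" .
    have "(\<Sum>i=1..n. (norm (z i))\<^sup>2) \<le> (\<Sum>i=1..n. 2 * Lmax * (f i w - f i x - grad (f i) x \<bullet> (w - x)))"
    proof (rule sum_mono)
      fix i assume i: "i \<in> {1..n}"
      have "(norm (z i))\<^sup>2 \<le> 2 * Ls i * (f i w - f i x - grad (f i) x \<bullet> (w - x))"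
        using smooth_convex_cocoercive[OF convex[OF i] diff[OF i] smooth[OF i], of w x]
        by (simp add: z_def norm_minus_commute)
      also have "\<dots> \<le> 2 * Lmax * (f i w - f i x - grad (f i) x \<bullet> (w - x))"
        using Ls_le[OF i] convex_ge_tangent[OF convex[OF i] GDERIV_grad[OF diff[OF i]], of x w]
        by (intro mult_right_mono) auto
      finally show "(norm (z i))\<^sup>2 \<le> 2 * Lmax * (f i w - f i x - grad (f i) x \<bullet> (w - x))" .
    qed
    then have "(\<Sum>i=1..n. (norm (z i))\<^sup>2) / real n
        \<le> (\<Sum>i=1..n. 2 * Lmax * (f i w - f i x - grad (f i) x \<bullet> (w - x))) / real n"
      by (intro divide_right_mono) auto
    also have "(\<Sum>i=1..n. 2 * Lmax * (f i w - f i x - grad (f i) x \<bullet> (w - x)))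
        = 2 * Lmax * ((\<Sum>i=1..n. f i w) - (\<Sum>i=1..n. f i x) - (\<Sum>i=1..n. grad (f i) x) \<bullet> (w - x))"
      by (simp only: sum_distrib_left[symmetric] sum_subtractf inner_sum_left)
    also have "\<dots> / real n = 2 * Lmax * Br"
    proof -
      have "Br = ((\<Sum>i=1..n. f i w) - (\<Sum>i=1..n. f i x) - (\<Sum>i=1..n. grad (f i) x) \<bullet> (w - x)) / real n"
        by (simp add: Br_def f_avg_def grad_F inverse_eq_divide diff_divide_distrib)
      then show ?thesis by simp
    qed
    finally show "(\<Sum>i=1..n. (norm (z i))\<^sup>2) / real n \<le> 2 * Lmax * Br" .
  qed
  also have "\<dots> = 2 * \<Lambda> * Br" by (simp add: exp_smooth_eq algebra_simps)
  finally have 2: "batch_mean n b (\<lambda>B. (norm ((\<Sum>i\<in>B. z i) /\<^sub>R real b))\<^sup>2) \<le> 2 * \<Lambda> * Br" .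
  have Br0: "0 \<le> Br"
    using convex_ge_tangent[OF convex_F GDERIV_grad[OF diff_F], of x w] by (simp add: Br_def)
  have "2 * \<mu>' * Br \<le> (norm d)\<^sup>2"
    unfolding Br_def d_def
    by (rule strongly_convex_bregman_le[OF strongly_convex_mono[OF strong_F assms(2)] assms(1)])
  moreover have "0 \<le> \<mu>' * Br" using assms Br0 by simp
  moreover have "(2 * \<Lambda> - \<mu>') * ((F w - F xs) + grad F x \<bullet> (x - w)) + \<mu>' * (F x - F xs)
      = 2 * \<Lambda> * Br - \<mu>' * Br + 2 * \<Lambda> * (F x - F xs)"
    by (simp add: Br_def inner_diff_right algebra_simps)
  ultimately show ?thesis using 1 2 grad_F_sq_le[of x] by linarith
qed

end

section \<open>One iteration as an average over batches and coin tosses\<close>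

context finite_sum_problem
begin

text \<open>One iteration with the random choices made explicit: the batch and the coin.\<close>

definition markov_step :: "real \<Rightarrow> real \<Rightarrow> 'a \<times> 'a \<times> real \<Rightarrow> nat set \<Rightarrow> bool \<Rightarrow> 'a \<times> 'a \<times> real" where
  "markov_step p \<alpha> = (\<lambda>(x, w, a) B coin. let x' = x - a *\<^sub>R estimator B x w in
     if coin then (x', x, \<alpha>) else (x', w, sqrt (1 - p) * a))"

lemma lsvrgd_step_eq:
  "lsvrgd_step n f b p \<alpha> st
    = bind_pmf (pmf_of_set (batches n b)) (\<lambda>B. map_pmf (markov_step p \<alpha> st B) (bernoulli_pmf p))"
proof -
  obtain x w a where st: "st = (x, w, a)" by (cases st)
  have fin: "finite (batches n b)" "batches n b \<noteq> {}"
    using finite_batches card_batches_pos[OF b_le] by auto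
  show ?thesis
    unfolding st lsvrgd_step_def nice_sampling_def batches_def[symmetric] case_prod_conv bind_map_pmf
  proof (intro bind_pmf_cong refl)
    fix B assume "B \<in> set_pmf (pmf_of_set (batches n b))"
    then have B: "B \<in> batches n b" using fin by simp
    have "grad (f_sub n f (sampling_vector n b B)) x - grad (f_sub n f (sampling_vector n b B)) w + grad F w
        = estimator B x w"
      unfolding grad_f_sub[OF B] estimator_def by (simp add: sum_subtractf scaleR_diff_right)
    then show "bernoulli_pmf p \<bind> (\<lambda>coin. let g = grad (f_sub n f (sampling_vector n b B)) x
          - grad (f_sub n f (sampling_vector n b B)) w + grad F w; x' = x - a *\<^sub>R g
        in return_pmf (if coin then (x', x, \<alpha>) else (x', w, sqrt (1 - p) * a)))
      = map_pmf (markov_step p \<alpha> (x, w, a) B) (bernoulli_pmf p)"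
      unfolding map_pmf_def by (simp add: Let_def markov_step_def)
  qed
qed

lemma finite_lsvrgd_step: "finite (set_pmf (lsvrgd_step n f b p \<alpha> st))"
proof -
  have "finite (batches n b)" "batches n b \<noteq> {}"
    using finite_batches card_batches_pos[OF b_le] by auto
  then show ?thesis by (auto simp: lsvrgd_step_eq)
qed

lemma finite_lsvrgd: "finite (set_pmf (lsvrgd n f b p \<alpha> x0 k))"
  by (induction k) (auto simp: finite_lsvrgd_step)

lemma expectation_lsvrgd_step:
  fixes \<phi> :: "'a \<times> 'a \<times> real \<Rightarrow> real"
  assumes "0 \<le> p" "p \<le> 1"
  shows "measure_pmf.expectation (lsvrgd_step n f b p \<alpha> (x, w, a)) \<phi>
    = batch_mean n b (\<lambda>B. p * \<phi> (x - a *\<^sub>R estimator B x w, x, \<alpha>)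
        + (1 - p) * \<phi> (x - a *\<^sub>R estimator B x w, w, sqrt (1 - p) * a))"
proof -
  have fin: "finite (batches n b)" "batches n b \<noteq> {}"
    using finite_batches card_batches_pos[OF b_le] by auto
  show ?thesis
    unfolding lsvrgd_step_eq using fin assms
    by (subst pmf_expectation_bind_pmf_of_set)
      (auto simp: batch_mean_def sum_distrib_left markov_step_def Let_def mult.commute[of p] mult.commute[of "1 - p"])
qed

end

lemma expectation_bind_finite:
  fixes \<phi> :: "'b \<Rightarrow> real"
  assumes "finite (set_pmf P)" "\<And>x. finite (set_pmf (K x))"
  shows "measure_pmf.expectation (bind_pmf P K) \<phi> = measure_pmf.expectation P (\<lambda>x. measure_pmf.expectation (K x) \<phi>)"
  using assms by (subst pmf_expectation_bind[of "set_pmf P"]) (auto simp: integral_measure_pmf[of "set_pmf P"])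

section \<open>The initial step size\<close>

text \<open>The product of initial step size and expected smoothness constant, \<open>1/(2 \<zeta>\<^sub>p)\<close>, is a rational
  function of \<open>u = sqrt (1 - p)\<close>, because the common factor \<open>1 - u\<close> of \<open>1 - (1 - p) powr (3/2)\<close>
  and \<open>p\<close> cancels.\<close>

definition scaled_step :: "real \<Rightarrow> real" where
  "scaled_step u = (1 + u) * (1 + u^2) * (1 + 2 * u^2) / ((3 + 4 * u^2) * (1 + u + u^2)) * (1/2)"

lemma scaled_step_denominator_pos: "0 \<le> u \<Longrightarrow> 0 < (3 + 4 * u^2) * (1 + u + u^2)" for u :: real
  by (intro mult_pos_pos add_pos_nonneg) auto

lemma inverse_zeta:
  assumes "0 < p" "p \<le> 1"
  shows "1 / (2 * zeta_p p) = scaled_step (sqrt (1 - p))"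
proof -
  define u where "u = sqrt (1 - p)"
  have u: "0 \<le> u" "u < 1" "p = 1 - u^2" using assms by (auto simp: u_def)
  have pw: "(1 - p) powr (3/2) = u^3"
  proof (cases "u = 0")
    case False
    then have "0 < u" using u by simp
    have "(1 - p) powr (3/2) = (u powr 2) powr (3/2)" using \<open>0 < u\<close> u by simp
    also have "\<dots> = u powr 3" by (simp only: powr_powr) simp
    finally show ?thesis using \<open>0 < u\<close> by simp
  qed (use u in simp)
  have "zeta_p p = (3 + 4 * u^2) * ((1 - u) * (1 + u + u^2)) / (((1 - u) * (1 + u)) * (1 + u^2) * (1 + 2 * u^2))"
  proof -
    have "1 - u^3 = (1 - u) * (1 + u + u^2)" "1 - u^2 = (1 - u) * (1 + u)" by algebra+
    moreover have "7 - 4 * p = 3 + 4 * u^2" "2 - p = 1 + u^2" "3 - 2 * p = 1 + 2 * u^2" using u by auto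
    ultimately show ?thesis unfolding zeta_p_def pw using u(3) by (simp only:)
  qed
  also have "\<dots> = (3 + 4 * u^2) * (1 + u + u^2) / ((1 + u) * (1 + u^2) * (1 + 2 * u^2))"
    using u(2) by (simp add: mult.assoc mult.left_commute[of _ "1 - u"])
  finally show ?thesis unfolding scaled_step_def u_def[symmetric] by simp
qed

lemma scaled_step_lower:
  assumes "0 \<le> u" "u \<le> 1"
  shows "1/6 \<le> scaled_step u"
proof -
  \<comment> \<open>Bernstein form: nonnegative coefficients, so the polynomial is nonnegative on the unit interval.\<close>
  have eq: "3 * (1 + u) * (1 + u^2) * (1 + 2 * u^2) - (3 + 4 * u^2) * (1 + u + u^2) = 2 * u^2 * (1 - u)^3 + 11 * u^3 * (1 - u)^2 + 18 * u^4 * (1 - u) + 15 * u^5"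
    by algebra
  have "0 \<le> 3 * (1 + u) * (1 + u^2) * (1 + 2 * u^2) - (3 + 4 * u^2) * (1 + u + u^2)"
    unfolding eq using assms by (intro add_nonneg_nonneg mult_nonneg_nonneg zero_le_power) auto
  then have "1/3 * ((3 + 4 * u^2) * (1 + u + u^2)) \<le> (1 + u) * (1 + u^2) * (1 + 2 * u^2)" by argo
  then have "1/3 \<le> (1 + u) * (1 + u^2) * (1 + 2 * u^2) / ((3 + 4 * u^2) * (1 + u + u^2))"
    using scaled_step_denominator_pos[OF assms(1)] by (simp only: pos_le_divide_eq)
  from mult_right_mono[OF this, of "1/2"] have "1/3 * (1/2) \<le> scaled_step u" unfolding scaled_step_def by (simp only:)
  then show ?thesis by simp
qed

lemma scaled_step_upper:
  assumes "0 \<le> u" "u \<le> 1"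
  shows "scaled_step u \<le> (1 + u) / (6 + u)"
proof -
  have eq: "2 * (3 + 4 * u^2) * (1 + u + u^2) - (1 + u^2) * (1 + 2 * u^2) * (6 + u) = 5 * u * (1 - u)^4 + 16 * u^2 * (1 - u)^3 + 23 * u^3 * (1 - u)^2 + 14 * u^4 * (1 - u)"
    by algebra
  have "0 \<le> 2 * (3 + 4 * u^2) * (1 + u + u^2) - (1 + u^2) * (1 + 2 * u^2) * (6 + u)"
    unfolding eq using assms by (intro add_nonneg_nonneg mult_nonneg_nonneg zero_le_power) auto
  then have "(1 + u^2) * (1 + 2 * u^2) * (6 + u) \<le> 2 * ((3 + 4 * u^2) * (1 + u + u^2))" by argo
  then have "(1 + u^2) * (1 + 2 * u^2) \<le> 2 * ((3 + 4 * u^2) * (1 + u + u^2)) / (6 + u)"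
    using assms by (simp only: pos_le_divide_eq)
  then have "(1 + u^2) * (1 + 2 * u^2) \<le> 2 / (6 + u) * ((3 + 4 * u^2) * (1 + u + u^2))" by simp
  then have "(1 + u^2) * (1 + 2 * u^2) / ((3 + 4 * u^2) * (1 + u + u^2)) \<le> 2 / (6 + u)"
    using scaled_step_denominator_pos[OF assms(1)] by (simp only: pos_divide_le_eq)
  then have "(1 + u) * (1/2) * ((1 + u^2) * (1 + 2 * u^2) / ((3 + 4 * u^2) * (1 + u + u^2))) \<le> (1 + u) * (1/2) * (2 / (6 + u))"
    using assms by (intro mult_left_mono) auto
  moreover have "(1 + u) * (1/2) * (2 / (6 + u)) = (1 + u) / (6 + u)" using assms by (simp add: field_simps)
  moreover have "(1 + u) * (1/2) * (X / Y) = (1 + u) * X / Y * (1/2)" for X Y :: real by simp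
  ultimately show ?thesis by (simp only: scaled_step_def mult.assoc[of "1 + u" "1 + u^2"])
qed

text \<open>The right-hand side is \<open>p/\<alpha>\<close> times the factor of \<open>f(w\<^sup>0) - f(x\<^sup>*)\<close> in \<open>\<phi>\<^sup>0\<close>, since
  \<open>3 - 2p = 1 + 2u\<^sup>2\<close>. The left-hand side is the weight that the Lyapunov function uses; it is
  tight up to a small margin at \<open>u = 1\<close>.\<close>

lemma scaled_step_weight:
  assumes "0 \<le> u" "u \<le> 1"
  shows "1 - 6/25 * u \<le> 8 * scaled_step u / (1 + 2 * u^2)"
proof -
  have eq: "4 * (1 + u) * (1 + u^2) - (1 - 6/25 * u) * (3 + 4 * u^2) * (1 + u + u^2) = 1 * (1 - u)^5 + 168/25 * u * (1 - u)^4 + 73/5 * u^2 * (1 - u)^3 + 379/25 * u^3 * (1 -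
      u)^2 + 134/25 * u^4 * (1 - u) + 1/25 * u^5"
    by algebra
  have "0 \<le> 4 * (1 + u) * (1 + u^2) - (1 - 6/25 * u) * (3 + 4 * u^2) * (1 + u + u^2)"
    unfolding eq using assms by (intro add_nonneg_nonneg mult_nonneg_nonneg zero_le_power) auto
  moreover have pos: "0 < (3 + 4 * u^2) * (1 + u + u^2)" by (rule scaled_step_denominator_pos[OF assms(1)])
  ultimately have "1 - 6/25 * u \<le> 4 * (1 + u) * (1 + u^2) / ((3 + 4 * u^2) * (1 + u + u^2))"
    by (simp only: pos_le_divide_eq mult.assoc)
  also have "\<dots> = 8 * scaled_step u / (1 + 2 * u^2)"
  proof -
    have "0 < 1 + 2 * u^2" by (intro add_pos_nonneg) auto
    then show ?thesis unfolding scaled_step_def using pos by (simp add: divide_simps)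
  qed
  finally show ?thesis .
qed

section \<open>The weights of the Lyapunov function\<close>

lemma affine_nonneg:
  fixes a b x :: real
  assumes "0 \<le> x" "x \<le> 1" "0 \<le> a" "0 \<le> a + b"
  shows "0 \<le> a + b * x"
proof -
  have "a + b * x = (1 - x) * a + x * (a + b)" by algebra
  then show ?thesis using assms by simp
qed

text \<open>A convex quadratic is bounded below by its tangent at \<open>t\<close>, and a tangent only has to be
  checked at the end points. The point \<open>t\<close> is chosen near the minimum.\<close>

lemma quadratic_nonneg_by_tangent:
  fixes a b c s t :: real
  assumes "0 \<le> s" "s \<le> 1" "0 \<le> c"
    and "0 \<le> a - c * t^2" "0 \<le> a + b + c * (2 * t - t^2)"
  shows "0 \<le> a + b * s + c * s^2"
proof -
  have "0 \<le> (a - c * t^2) + (b + 2 * c * t) * s"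
    by (rule affine_nonneg) (use assms in \<open>auto simp: algebra_simps\<close>)
  moreover have "0 \<le> c * (s - t)^2" using assms by simp
  ultimately show ?thesis by (simp add: power2_eq_square algebra_simps)
qed

text \<open>Profile by which the weight of \<open>|x - x\<^sup>*|\<^sup>2\<close> grows while the step size shrinks from \<open>\<alpha>\<close> (\<open>s = 1\<close>)
  towards zero (\<open>s = 0\<close>).\<close>

definition eta :: "real \<Rightarrow> real" where
  "eta s = (1 - s) * (1 - 3/4 * s)"

lemma eta_nonneg: "0 \<le> s \<Longrightarrow> s \<le> 1 \<Longrightarrow> 0 \<le> eta s"
  by (simp add: eta_def)

lemma eta_le: assumes "0 \<le> s" "s \<le> 1" shows "eta s \<le> 1 - s"
  using mult_left_mono[of "1 - 3/4 * s" 1 "1 - s"] assms by (simp add: eta_def)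

text \<open>Parameters of the scalar inequalities. Here \<open>u = sqrt (1 - p)\<close>, \<open>\<kappa>\<close> is the product of \<open>\<alpha>\<close> and the
  expected smoothness constant, and \<open>\<gamma> \<le> 1\<close> encodes the contraction: one iteration contracts by
  \<open>\<rho> = 1 - \<gamma>p/2\<close>, and \<open>m = 3\<gamma>p/4\<close> is the product of \<open>\<alpha>\<close> and the part of the strong convexity that
  is used for it. The variable \<open>s \<in> [0, 1]\<close> is the current step size divided by \<open>\<alpha>\<close>; it is
  \<open>u\<^sup>j\<close> after \<open>j\<close> failed coin tosses.

  The two bounds on \<open>\<kappa>\<close> hold for \<open>\<kappa> = 1/(2 \<zeta>\<^sub>p)\<close>; they take the place of this rational function in
  order to keep the degrees low. The last assumption is \<open>m \<le> \<kappa>\<close>, which holds because \<open>\<mu>\<close> is at most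
  the expected smoothness constant.\<close>

locale svrg_rates =
  fixes u \<gamma> \<kappa> :: real
  assumes u_nonneg: "0 \<le> u" and u_less: "u < 1"
    and gamma_pos: "0 < \<gamma>" and gamma_le: "\<gamma> \<le> 1"
    and kappa_lower: "1/6 \<le> \<kappa>" and kappa_upper: "\<kappa> \<le> (1 + u) / (6 + u)"
    and mu_le_kappa: "3/4 * \<gamma> * (1 - u^2) \<le> \<kappa>"
begin

text \<open>The Lyapunov function has weight \<open>h s\<close> on \<open>|x - x\<^sup>*|\<^sup>2\<close>, \<open>wt s\<close> on \<open>|x - w|\<^sup>2\<close>, \<open>c s\<close> on the gap at
  \<open>w\<close>, and \<open>(C/\<rho>) (1 - s)\<close> on the tail sum that is defined below. The other quantities appear when
  one step is expanded: \<open>H s\<close> is the mean of the weight \<open>h\<close> after the coin toss, \<open>\<Theta> s\<close>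
  bounds the mean of the weight on \<open>|x - w|\<^sup>2\<close> after a failed toss (\<open>\<theta>0\<close> is \<open>\<theta>\<close> at \<open>\<gamma> = 0\<close>), \<open>\<Gamma> s\<close> collects all factors of the
  second moment of the estimator, and \<open>- s S s\<close> is the factor left on the gap at \<open>x\<close>.
  The discount \<open>r = (1-p)/\<rho>\<close> is the probability of a failed toss relative to the
  contraction, \<open>\<beta>\<close> is an upper bound of \<open>\<kappa>/(1-\<kappa>)\<close>, and \<open>C/p = c 1\<close> is the weight that a
  successful toss puts on the gap at the old iterate. The slope \<open>6/25\<close> and the factor \<open>3/4\<close> in \<open>eta\<close>
  are fitted so that all inequalities below hold with a margin; \<open>3/5\<close> is half of \<open>1/(1-\<kappa>)\<close> at
  \<open>\<kappa> = 1/6\<close>.\<close>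

definition "p = 1 - u^2"
definition "m = 3/4 * \<gamma> * p"
definition "\<rho> = 1 - 1/2 * \<gamma> * p"
definition "r = u^2 / \<rho>"
definition "C = 1 - 6/25 * u"
definition "\<beta> = 1/5 * (1 + u)"
definition "\<theta>0 = 1/10 * (1 + u) * (3 - u^2)"
definition "\<theta> = (\<beta> - 3/5 * m) * (1 + 1/2 * p)"
definition "h s = 1 + \<gamma> * eta s"
definition "H s = p + u^2 * h (u * s)"
definition "\<Theta> s = \<theta> * s * H s"
definition "wt s = (\<Theta> s + C * s * (1 - u) * \<beta> / 2) / \<rho>"
definition "c s = C / p * s^2 * (1 + eta s)"
definition "\<omega> = (1 - u) / (1 - r)"
definition "\<Gamma> s = H s + \<Theta> s + 1/2 * p"
definition "S s = 2 * H s - C * (u + \<omega>) - m * s * \<Gamma> s"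

lemma u_le: "u \<le> 1" using u_less by simp

lemma u_sq: "0 \<le> u^2" "u^2 < 1" "u^2 \<le> u"
  using u_nonneg u_less by (auto simp: power2_eq_square abs_square_less_1 mult_left_le power_less_one_iff[of u 2, unfolded power2_eq_square])

lemma p_bounds: "0 < p" "p \<le> 1" using u_sq by (auto simp: p_def)

lemma p_factor: "p = (1 - u) * (1 + u)" unfolding p_def by algebra

lemma m_bounds: "0 \<le> m" "m \<le> \<kappa>" "m \<le> 2/7"
proof -
  have "(1 + u) / (6 + u) \<le> 2/7" using u_nonneg u_less by (simp add: field_simps)
  then have "\<kappa> \<le> 2/7" using kappa_upper by linarith
  then show "0 \<le> m" "m \<le> \<kappa>" "m \<le> 2/7"
    using mu_le_kappa gamma_pos p_bounds by (auto simp: m_def p_def)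
qed

lemma gamma_p: "0 \<le> \<gamma> * p" "\<gamma> * p \<le> p"
  using gamma_pos gamma_le p_bounds by (auto simp: mult_left_le_one_le)

lemma rho_bounds: "(1 + u^2) / 2 \<le> \<rho>" "1/2 \<le> \<rho>" "\<rho> \<le> 1" "u^2 < \<rho>" "u \<le> \<rho>"
proof -
  show 1: "(1 + u^2) / 2 \<le> \<rho>" using gamma_p by (simp add: \<rho>_def p_def)
  show "1/2 \<le> \<rho>" using 1 zero_le_power2[of u] by argo
  show "u^2 < \<rho>" using 1 u_sq(2) by simp
  show "\<rho> \<le> 1" using gamma_p by (simp add: \<rho>_def)
  have "0 \<le> (1 - u)^2" by simp
  then show "u \<le> \<rho>" using 1 by (simp add: power2_eq_square algebra_simps)
qed

lemma r_bounds: "0 \<le> r" "r < 1" "r \<le> u" "r * \<rho> = u^2"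
proof -
  have "u * u \<le> u * \<rho>" using rho_bounds u_nonneg by (intro mult_left_mono) auto
  then show "0 \<le> r" "r < 1" "r \<le> u" "r * \<rho> = u^2"
    using rho_bounds by (auto simp: r_def power2_eq_square field_simps)
qed

lemma ru_less: "r * u < 1"
  using r_bounds u_nonneg u_less by (meson le_less_trans mult_left_le_one_le mult_left_le order_less_imp_le)

lemma H_eq: "H s = 1 + \<gamma> * (u^2 * eta (u * s))"
  by (simp add: H_def h_def p_def algebra_simps)

lemma us_bounds: "0 \<le> s \<Longrightarrow> s \<le> 1 \<Longrightarrow> 0 \<le> u * s \<and> u * s \<le> 1"
  using u_nonneg u_le by (simp add: mult_le_one)

lemma H_ge: "0 \<le> s \<Longrightarrow> s \<le> 1 \<Longrightarrow> 1 \<le> H s"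
  using us_bounds[of s] gamma_pos eta_nonneg[of "u * s"] by (simp add: H_eq)

lemma C_bounds: "0 < C" "C \<le> 1" using u_nonneg u_less by (auto simp: C_def)

lemma beta_bounds: "0 < \<beta>" using u_nonneg by (simp add: \<beta>_def)

lemma kappa_le_beta: "\<kappa> * (1 + \<beta>) \<le> \<beta>"
proof -
  have "\<kappa> * (1 + \<beta>) \<le> (1 + u) / (6 + u) * (1 + \<beta>)"
    using kappa_upper beta_bounds by (intro mult_right_mono) auto
  also have "\<dots> = \<beta>" using u_nonneg by (simp add: \<beta>_def field_simps)
  finally show ?thesis .
qed

lemma theta_eq: "\<theta> = \<theta>0 - \<gamma> * (9/20 * p * (1 + 1/2 * p))"
  unfolding \<theta>_def \<theta>0_def m_def \<beta>_def p_def by algebra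

lemma theta_ge: "\<beta> / 2 \<le> \<theta>"
proof -
  have "6 * m \<le> 1 + u"
  proof (cases "u \<le> 5/7")
    case True
    have "6 * ((1 + u) / (6 + u)) \<le> 1 + u" using u_nonneg by (simp add: field_simps)
    then show ?thesis using m_bounds kappa_upper by linarith
  qed (use m_bounds in simp)
  then have "\<beta> / 2 \<le> \<beta> - 3/5 * m" by (simp add: \<beta>_def field_simps)
  also have "\<dots> \<le> (\<beta> - 3/5 * m) * (1 + 1/2 * p)"
    using calculation beta_bounds p_bounds by simp
  finally show ?thesis by (simp add: \<theta>_def)
qed

lemma theta0_bounds: "0 \<le> \<theta>0" "\<theta>0 \<le> 9/20"
proof -
  show "0 \<le> \<theta>0" using u_nonneg u_sq(2) by (auto simp: \<theta>0_def intro!: mult_nonneg_nonneg)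
  have eq: "9/20 - \<theta>0 = 3/20 * (1 - u)^4 + 3/10 * u * (1 - u)^3 + 1/10 * u^2 * (1 - u)^2 + 1/20 * u^4"
    unfolding \<theta>0_def by algebra
  have "0 \<le> 9/20 - \<theta>0"
    unfolding eq using u_nonneg u_le by (intro add_nonneg_nonneg mult_nonneg_nonneg zero_le_power) auto
  then show "\<theta>0 \<le> 9/20" by simp
qed

lemma theta_le: "\<theta> \<le> \<theta>0"
  using gamma_pos p_bounds by (simp add: theta_eq)

lemma theta_pos: "0 < \<theta>" using theta_ge beta_bounds by simp

lemma Theta_nonneg: "0 \<le> s \<Longrightarrow> s \<le> 1 \<Longrightarrow> 0 \<le> \<Theta> s"
  using H_ge[of s] theta_pos by (simp add: \<Theta>_def)

text \<open>The noise, of size \<open>s\<^sup>2 \<Gamma>\<close> times the second moment, has an inner product \<open>grad f(x) \<bullet> (x - w)\<close> that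
  the drift of \<open>|x - w|\<^sup>2\<close> must absorb. This is the condition on \<open>\<Theta>\<close> for it; as \<open>\<Gamma>\<close> contains \<open>\<Theta>\<close>
  itself, it is solved by a factor of the form \<open>k/(1 - k)\<close> with \<open>k = \<kappa> - m/2\<close>.\<close>

lemma Theta_dominates:
  assumes "0 \<le> s" "s \<le> 1"
  shows "s * (\<kappa> - m/2) * \<Gamma> s \<le> \<Theta> s"
proof -
  let ?k = "\<kappa> - m/2" and ?b = "\<beta> - 3/5 * m"
  have k0: "0 \<le> ?k" and b0: "0 \<le> ?b"
    using m_bounds theta_pos p_bounds by (auto simp: \<theta>_def zero_less_mult_iff)
  have "?k * (1 + ?b) \<le> ?b"
  proof -
    have "6/5 \<le> 1 + \<beta>" using u_nonneg by (simp add: \<beta>_def)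
    then have "m/2 * (6/5) \<le> m/2 * (1 + \<beta>)" using m_bounds by (intro mult_left_mono) auto
    moreover have "0 \<le> ?k * (3/5 * m)" using k0 m_bounds by simp
    moreover have "?k * (1 + ?b) = \<kappa> * (1 + \<beta>) - m/2 * (1 + \<beta>) - ?k * (3/5 * m)" by algebra
    ultimately show ?thesis using kappa_le_beta by linarith
  qed
  have H1: "1 \<le> H s" using H_ge assms by simp
  have "?k * \<Gamma> s \<le> ?k * (H s * (1 + 1/2 * p) * (1 + ?b))"
  proof (rule mult_left_mono[OF _ k0])
    have "H s + 1/2 * p \<le> H s * (1 + 1/2 * p)" using H1 p_bounds by (simp add: algebra_simps)
    moreover have "\<Theta> s \<le> H s * \<theta>" using assms H1 theta_pos
      by (simp add: \<Theta>_def mult_left_le mult.commute)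
    moreover have "H s * (1 + 1/2 * p) * (1 + ?b) = H s * (1 + 1/2 * p) + H s * \<theta>"
      unfolding \<theta>_def by algebra
    ultimately show "\<Gamma> s \<le> H s * (1 + 1/2 * p) * (1 + ?b)" by (simp add: \<Gamma>_def)
  qed
  also have "\<dots> = H s * (1 + 1/2 * p) * (?k * (1 + ?b))" by algebra
  also have "\<dots> \<le> H s * (1 + 1/2 * p) * ?b"
    using \<open>?k * (1 + ?b) \<le> ?b\<close> H1 p_bounds by (intro mult_left_mono) auto
  also have "\<dots> = \<theta> * H s" by (simp add: \<theta>_def)
  finally have "s * (?k * \<Gamma> s) \<le> s * (\<theta> * H s)" using assms by (intro mult_left_mono)
  then show ?thesis by (simp add: \<Theta>_def algebra_simps)
qed

lemma wt_nonneg: "0 \<le> s \<Longrightarrow> s \<le> 1 \<Longrightarrow> 0 \<le> wt s"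
  using Theta_nonneg[of s] C_bounds beta_bounds rho_bounds u_less by (simp add: wt_def)

text \<open>The weight after a failed toss may be as large as \<open>\<Theta>\<close>. The loss from \<open>u\<^sup>2\<close> and from the smaller
  step size outweighs the growth of \<open>H\<close> and the part reserved for the tail sum, all of which are
  proportional to \<open>1 - u\<close>.\<close>

lemma wt_decrease:
  assumes "0 \<le> s" "s \<le> 1"
  shows "u^2 * wt (u * s) \<le> \<Theta> s"
proof -
  have b: "0 \<le> u * s" "u * s \<le> 1" "0 \<le> u * (u * s)" "u * (u * s) \<le> 1"
    using us_bounds[OF assms] us_bounds[of "u * s"] by auto
  have H1: "1 \<le> H s" using H_ge assms by simp
  let ?z = "u * s"
  have eta_diff: "eta (u * ?z) \<le> eta ?z + (1 - u)"
  proof -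
    have "?z * ?z \<le> ?z * ?z * (1 + u)" using u_nonneg by (intro mult_le_cancel_left1[THEN iffD2]) auto
    moreover have "0 \<le> eta ?z" using b eta_nonneg by simp
    moreover have "eta ?z = 1 - 7/4 * ?z + 3/4 * (?z * ?z)" unfolding eta_def by algebra
    ultimately have "7/4 * ?z - 3/4 * (?z * ?z * (1 + u)) \<le> 1" by linarith
    then have "(1 - u) * (7/4 * ?z - 3/4 * (?z * ?z * (1 + u))) \<le> 1 - u"
      using u_le by (simp add: mult_left_le)
    moreover have "eta (u * ?z) - eta ?z = (1 - u) * (7/4 * ?z - 3/4 * (?z * ?z * (1 + u)))"
      unfolding eta_def by algebra
    ultimately show ?thesis by simp
  qed
  have "H ?z \<le> H s + (1 - u) * u^2"
  proof -
    have "\<gamma> * (u^2 * (eta (u * ?z) - eta ?z)) \<le> \<gamma> * (u^2 * (1 - u))"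
      using eta_diff gamma_pos by (intro mult_left_mono) auto
    also have "\<dots> \<le> 1 * (u^2 * (1 - u))"
      using gamma_le u_le by (intro mult_right_mono) auto
    finally have "\<gamma> * (u^2 * (eta (u * ?z) - eta ?z)) \<le> 1 * (u^2 * (1 - u))" .
    then show ?thesis by (simp add: H_eq algebra_simps)
  qed
  have u3: "u^3 * (H s + (1 - u) * (1 + u^2)) \<le> \<rho> * H s"
  proof -
    have "u^3 \<le> u^2" "u^5 \<le> u"
      using u_nonneg u_le power_decreasing[of 2 3 u] power_decreasing[of 1 5 u] by auto
    moreover have "u^3 * (1 + u^2) = u^3 + u^5" by algebra
    ultimately have "u^3 * (1 + u^2) \<le> 1/2 * (1 + u + 2 * u^2)" using u_le by simp
    then have "(1 - u) * (u^3 * (1 + u^2)) \<le> (1 - u) * (1/2 * (1 + u + 2 * u^2))"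
      using u_le by (intro mult_left_mono) auto
    also have "\<dots> = 1/2 * (1 + u^2) - u^3" by algebra
    also have "\<dots> \<le> (\<rho> - u^3) * 1" using rho_bounds(1) by simp
    also have "\<dots> \<le> (\<rho> - u^3) * H s"
    proof (rule mult_left_mono[OF H1])
      have "u^3 \<le> u" using power_decreasing[of 1 3 u] u_nonneg u_le by simp
      then show "0 \<le> \<rho> - u^3" using rho_bounds by simp
    qed
    finally show ?thesis by (simp add: algebra_simps)
  qed
  have "C * ?z * (1 - u) * \<beta> / 2 \<le> \<theta> * ?z * (1 - u)"
  proof -
    have "C * (\<beta> / 2) \<le> 1 * \<theta>" using C_bounds theta_ge beta_bounds by (intro mult_mono) auto
    then have "C * (\<beta> / 2) * (?z * (1 - u)) \<le> 1 * \<theta> * (?z * (1 - u))"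
      using b u_le by (intro mult_right_mono) auto
    then show ?thesis by (simp add: algebra_simps)
  qed
  moreover have "\<Theta> ?z \<le> \<theta> * ?z * (H s + (1 - u) * u^2)"
    unfolding \<Theta>_def using \<open>H ?z \<le> _\<close> theta_pos b by (intro mult_left_mono) auto
  ultimately have "\<Theta> ?z + C * ?z * (1 - u) * \<beta> / 2 \<le> \<theta> * ?z * (H s + (1 - u) * (1 + u^2))"
    by (simp add: algebra_simps)
  then have "u^2 * (\<Theta> ?z + C * ?z * (1 - u) * \<beta> / 2) \<le> u^2 * (\<theta> * ?z * (H s + (1 - u) * (1 + u^2)))"
    by (intro mult_left_mono) auto
  also have "\<dots> = \<theta> * s * (u^3 * (H s + (1 - u) * (1 + u^2)))" by algebra
  also have "\<dots> \<le> \<theta> * s * (\<rho> * H s)"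
    using u3 theta_pos assms by (intro mult_left_mono) auto
  finally show ?thesis using rho_bounds by (simp add: wt_def \<Theta>_def field_simps)
qed

lemma wt_one: "wt 1 \<le> 1/2"
proof -
  have "eta u \<le> 1 - u" using eta_le u_nonneg u_le by simp
  have "H 1 \<le> 1 + \<gamma> * (u^2 * (1 - u))"
    using \<open>eta u \<le> 1 - u\<close> gamma_pos by (auto simp: H_eq intro!: mult_left_mono)
  then have "\<theta> * H 1 \<le> \<theta> * (1 + \<gamma> * (u^2 * (1 - u)))"
    using theta_pos by (intro mult_left_mono) auto
  also have "\<dots> = \<theta> + \<theta> * (\<gamma> * (u^2 * (1 - u)))" by (simp add: algebra_simps)
  also have "\<theta> * (\<gamma> * (u^2 * (1 - u))) \<le> 9/20 * (\<gamma> * (u^2 * (1 - u)))"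
    using theta_le theta0_bounds gamma_pos u_le by (intro mult_right_mono) auto
  also have "\<theta> \<le> \<theta>0 - \<gamma> * (9/20 * p)"
    using gamma_pos p_bounds by (simp add: theta_eq algebra_simps)
  finally have 1: "\<theta> * H 1 \<le> \<theta>0 - \<gamma> * (9/20 * p) + 9/20 * (\<gamma> * (u^2 * (1 - u)))" by simp
  have "0 \<le> (1/2 - \<theta>0 - 1/10 * C * p) + (1/5 * p - 9/20 * (u^2 * (1 - u))) * \<gamma>"
  proof (rule affine_nonneg)
    have eq: "1/2 - \<theta>0 - 1/10 * C * p = 1/10 * (1 - u)^5 + 28/125 * u * (1 - u)^4 + 12/125 * u^2 * (1 - u)^3 + 1/50 * u^3 * (1
      - u)^2 + 37/250 * u^4 * (1 - u) + 1/10 * u^5"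
      unfolding \<theta>0_def C_def p_def by algebra
    show "0 \<le> 1/2 - \<theta>0 - 1/10 * C * p" unfolding eq using u_nonneg u_le by (intro add_nonneg_nonneg mult_nonneg_nonneg zero_le_power) auto
    have eq': "(1/2 - \<theta>0 - 1/10 * C * p) + (1/5 * p - 9/20 * (u^2 * (1 - u))) = 3/10 * (1 - u)^5 + 153/125 * u * (1 - u)^4 + 723/500 * u^2 * (1 - u)^3 + 13/25 * u^3 *
      (1 - u)^2 + 49/500 * u^4 * (1 - u) + 1/10 * u^5"
      unfolding \<theta>0_def C_def p_def by algebra
    show "0 \<le> (1/2 - \<theta>0 - 1/10 * C * p) + (1/5 * p - 9/20 * (u^2 * (1 - u)))"
      unfolding eq' using u_nonneg u_le by (intro add_nonneg_nonneg mult_nonneg_nonneg zero_le_power) auto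
  qed (use gamma_pos gamma_le in auto)
  moreover have "\<gamma> * p = p * \<gamma>" "\<gamma> * (u^2 * (1 - u)) = u^2 * (1 - u) * \<gamma>" by simp_all
  ultimately have "\<theta> * H 1 + 1/10 * C * p \<le> 1/2 - p * \<gamma> / 4"
    using 1 by (simp only: left_diff_distrib)
  moreover have "C * (1 - u) * \<beta> / 2 = 1/10 * C * p" by (simp add: p_factor \<beta>_def field_simps)
  ultimately have "\<theta> * H 1 + C * (1 - u) * \<beta> / 2 \<le> \<rho> / 2"
    unfolding \<rho>_def by argo
  then show ?thesis using rho_bounds by (simp add: wt_def \<Theta>_def field_simps)
qed

text \<open>Only \<open>r \<le> 2u\<^sup>2/(1 + u\<^sup>2)\<close> is used, the value at \<open>\<gamma> = 1\<close>. Then both sides tend to \<open>1/2\<close> for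
  \<open>u \<rightarrow> 1\<close>, where there is little room for a loss.\<close>

lemma tail_noise_le: "(1 - u) / (1 - r * u) \<le> 1 - 3/4 * u + 1/4 * u^2"
proof -
  have rle: "r \<le> 2 * u^2 / (1 + u^2)"
  proof -
    have "r \<le> u^2 / ((1 + u^2) / 2)" unfolding r_def
      using rho_bounds(1,2) by (intro divide_left_mono mult_pos_pos) (auto intro: add_pos_nonneg)
    then show ?thesis by (simp add: mult.commute)
  qed
  let ?e = "1 - 3/4 * u + 1/4 * u^2"
  have e0: "0 \<le> ?e" using u_nonneg u_le zero_le_power2[of u] by linarith
  have pos: "0 < 1 + u^2" using zero_le_power2[of u] by linarith
  have "0 \<le> 1/4 * u * (1 - u)^2 * (1 + 3 * u - 2 * u^2)"
    using u_nonneg u_le u_sq(3) by (intro mult_nonneg_nonneg) auto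
  moreover have "?e * (1 + u^2 - 2 * u^2 * u) - (1 - u) * (1 + u^2)
      = 1/4 * u * (1 - u)^2 * (1 + 3 * u - 2 * u^2)"
    by algebra
  ultimately have "(1 - u) * (1 + u^2) \<le> ?e * (1 + u^2 - 2 * u^2 * u)" by simp
  then have "1 - u \<le> ?e * (1 + u^2 - 2 * u^2 * u) / (1 + u^2)"
    using pos by (simp only: pos_le_divide_eq)
  also have "\<dots> = ?e * (1 - 2 * u^2 / (1 + u^2) * u)"
  proof -
    have "1 - 2 * u^2 / (1 + u^2) * u = (1 + u^2 - 2 * u^2 * u) / (1 + u^2)"
      using pos by (simp add: diff_divide_distrib)
    then show ?thesis by simp
  qed
  also have "\<dots> \<le> ?e * (1 - r * u)"
    using mult_right_mono[OF rle u_nonneg] e0 by (intro mult_left_mono) auto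
  finally show ?thesis using ru_less by (simp add: field_simps)
qed

lemma c_nonneg:
  assumes "0 \<le> s" "s \<le> 1"
  shows "0 \<le> c s"
proof -
  have "0 \<le> C / p * s^2 * (1 + eta s)"
    using C_bounds p_bounds eta_nonneg[OF assms] by (intro mult_nonneg_nonneg divide_nonneg_nonneg) auto
  then show ?thesis by (simp add: c_def)
qed

text \<open>The exact value is \<open>\<rho>/((1 + u)(1 - \<gamma>/2))\<close>; the bound is affine in \<open>\<gamma>\<close>
  and agrees with it for \<open>u = 1\<close> and \<open>\<gamma> \<in> {0, 1}\<close>.\<close>

lemma omega_le: "\<omega> \<le> 1/2 * u * (1 + \<gamma>) + 9/8 * (1 - u)"
proof -
  let ?B = "1/2 * u * (1 + \<gamma>) + 9/8 * (1 - u)"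
  have "(1 + \<gamma>) * (1 - \<gamma>/2) = 9/8 - 1/2 * (\<gamma> - 1/2)^2" by algebra
  then have "(1 + \<gamma>) * (1 - \<gamma>/2) \<le> 9/8" by simp
  from mult_left_mono[OF this, of "1 - u"] have "(1 - u) * ((1 + \<gamma>) * (1 - \<gamma>/2)) \<le> 9/8 * (1 - u)"
    using u_le by (simp only: mult.commute[of "9/8"])
  moreover have "(1 + \<gamma>) * (1 - u/2 - 1/2 * \<gamma> * (1 - u))
      = 1/2 * u * (1 + \<gamma>) + (1 - u) * ((1 + \<gamma>) * (1 - \<gamma>/2))"
    by (simp add: field_simps)
  ultimately have B: "(1 + \<gamma>) * (1 - u/2 - 1/2 * \<gamma> * (1 - u)) \<le> ?B" by simp
  have "0 \<le> \<gamma> * (1 - \<gamma>) / 2" using gamma_pos gamma_le by simp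
  then have gamma1: "1 \<le> (1 + \<gamma>) * (1 - \<gamma>/2)" by (simp add: algebra_simps)
  have d: "\<rho> - u^2 = p * (1 - \<gamma>/2)" unfolding \<rho>_def p_def by algebra
  have "\<rho> \<le> (1 + u) * (1 - u/2 - 1/2 * \<gamma> * (1 - u))"
  proof -
    have "(1 + u) * (1 - u/2 - 1/2 * \<gamma> * (1 - u)) - \<rho> = 1/2 * u * (1 - u)"
      unfolding \<rho>_def p_def by algebra
    moreover have "0 \<le> 1/2 * u * (1 - u)" using u_nonneg u_le by simp
    ultimately show ?thesis by simp
  qed
  then have "\<rho> * 1 \<le> (1 + u) * (1 - u/2 - 1/2 * \<gamma> * (1 - u)) * ((1 + \<gamma>) * (1 - \<gamma>/2))"
    using gamma1 rho_bounds(2) by (intro mult_mono) auto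
  also have "\<dots> = (1 + u) * (1 - \<gamma>/2) * ((1 + \<gamma>) * (1 - u/2 - 1/2 * \<gamma> * (1 - u)))" by algebra
  also have "\<dots> \<le> (1 + u) * (1 - \<gamma>/2) * ?B"
    using B u_nonneg gamma_le by (intro mult_left_mono) auto
  finally have "\<rho> \<le> (1 + u) * (1 - \<gamma>/2) * ?B" by simp
  then have "(1 - u) * \<rho> \<le> (1 - u) * ((1 + u) * (1 - \<gamma>/2) * ?B)"
    using u_le by (intro mult_left_mono) auto
  also have "\<dots> = ?B * (\<rho> - u^2)" unfolding d p_factor by algebra
  also have "\<rho> - u^2 = (1 - r) * \<rho>" using r_bounds(4) by (simp add: algebra_simps)
  also have "?B * ((1 - r) * \<rho>) = ?B * (1 - r) * \<rho>" by simp
  finally have "1 - u \<le> ?B * (1 - r)" using rho_bounds(2) by (simp add: mult_le_cancel_right)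
  then show ?thesis using r_bounds(2) by (simp add: \<omega>_def pos_divide_le_eq)
qed

lemma Gamma_eq: "\<Gamma> s = H s * (1 + \<theta> * s) + 1/2 * p"
  by (simp add: \<Gamma>_def \<Theta>_def algebra_simps)

lemma Gamma_nonneg: "0 \<le> s \<Longrightarrow> s \<le> 1 \<Longrightarrow> 0 \<le> \<Gamma> s"
  using H_ge[of s] Theta_nonneg[of s] p_bounds by (simp add: \<Gamma>_def)

text \<open>The gap at \<open>x\<close> keeps a nonpositive factor for every step size. Without the tail sum this
  fails for small \<open>s\<close>: the factor would then be \<open>C\<close> minus a multiple of \<open>s\<close>.\<close>

lemma S_nonneg:
  assumes "0 \<le> s" "s \<le> 1"
  shows "0 \<le> S s"
proof -
  define x where "x = m * s * (1 + \<theta> * s)"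
  have th: "\<theta> * s \<le> 9/20"
    using mult_mono[of \<theta> "9/20" s 1] theta_le theta0_bounds assms by auto
  have ms: "m * s \<le> 2/7" "0 \<le> m * s"
    using mult_mono[of m "2/7" s 1] m_bounds assms by auto
  have x: "x \<le> 2/7 * (29/20)"
    unfolding x_def using ms th theta_pos assms by (intro mult_mono) auto
  have "(2 - x) * 1 \<le> (2 - x) * H s"
    using x H_ge[OF assms] by (intro mult_left_mono) auto
  moreover have "m * s * (1/2 * p) \<le> 2/7 * (1/2 * p)" using ms p_bounds by (intro mult_right_mono) auto
  moreover have "C * (u + \<omega>) \<le> C * (9/8 + 7/8 * u)"
  proof (rule mult_left_mono)
    have "u * (1 + \<gamma>) \<le> u * 2" using u_nonneg gamma_le by (intro mult_left_mono) auto
    then show "u + \<omega> \<le> 9/8 + 7/8 * u" using omega_le by argo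
  qed (use C_bounds in simp)
  moreover have "0 \<le> 2 - 2/7 * (29/20 + 1/2 * p) - C * (9/8 + 7/8 * u)"
  proof -
    have eq: "2 - 2/7 * (29/20 + 1/2 * p) - C * (9/8 + 7/8 * u) = 89/280 * (1 - u)^2 + 43/1400 * u * (1 - u) + 23/350 * u^2"
      unfolding p_def C_def by algebra
    show ?thesis unfolding eq using u_nonneg u_le
      by (intro add_nonneg_nonneg mult_nonneg_nonneg zero_le_power) auto
  qed
  moreover have "S s = (2 - x) * H s - C * (u + \<omega>) - m * s * (1/2 * p)"
    unfolding S_def Gamma_eq x_def by algebra
  ultimately show ?thesis using x by argo
qed

text \<open>The weight on the gap at \<open>w\<close> pays for the noise of the step and of the tail sum. Divided by
  \<open>s\<^sup>2\<close>, the slack is bounded below by a function affine in \<open>\<gamma>\<close>, so only \<open>\<gamma> = 0\<close> and \<open>\<gamma> = 1\<close>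
  matter; both are convex quadratics in \<open>s\<close>. The case \<open>\<gamma> = 1\<close>, \<open>u \<rightarrow> 1\<close>, \<open>s \<approx> 3/4\<close> leaves
  little room; it determines the choices of \<open>eta\<close> and of \<open>t = 3/4\<close>.\<close>

lemma c_recursion:
  assumes "0 \<le> s" "s \<le> 1"
  shows "u^2 * c (u * s) + 2 * s * \<Theta> s + C * s * (1 - u) * (\<beta> * s / (1 - r * u)) \<le> \<rho> * c s"
proof -
  define a0 where "a0 = 2 * (1 + u^2)"
  define a1 where "a1 = 7/4 * (1 + u^2 + u^4 * (1 - u/2))"
  define a2 where "a2 = 3/4 * (1 + u^2 + u^4)"
  define e where "e = 1 - 3/4 * u + 1/4 * u^2"
  define F0 where "F0 = C * (a0 - a1 * s + a2 * s^2) - 2 * \<theta>0 - C * \<beta> * e"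
  define F1 where "F1 = 9/10 * p * (1 + 1/2 * p) - 1/2 * C * (1 + eta s) - 2 * \<theta>0 * (u^2 * eta (u * s))"
  define X where "X = C / p * (\<rho> * (1 + eta s) - u^4 * (1 + eta (u * s))) - 2 * (\<theta> * H s) - C * \<beta> * ((1 - u) / (1 - r * u))"
  have us: "0 \<le> u * s" "u * s \<le> 1" using us_bounds[OF assms] by auto
  have "F0 + F1 * \<gamma> \<le> X"
  proof -
    have "\<rho> * (1 + eta s) - u^4 * (1 + eta (u * s))
        - p * (a0 - a1 * s + a2 * s^2 - \<gamma>/2 * (1 + eta s)) = 7/8 * s * u^5 * (1 - u)^2"
      unfolding \<rho>_def p_def a0_def a1_def a2_def eta_def by algebra
    moreover have "0 \<le> 7/8 * s * u^5 * (1 - u)^2"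
      using assms u_nonneg by (intro mult_nonneg_nonneg) auto
    ultimately have "p * (a0 - a1 * s + a2 * s^2 - \<gamma>/2 * (1 + eta s))
        \<le> \<rho> * (1 + eta s) - u^4 * (1 + eta (u * s))" by simp
    then have "C / p * (p * (a0 - a1 * s + a2 * s^2 - \<gamma>/2 * (1 + eta s)))
        \<le> C / p * (\<rho> * (1 + eta s) - u^4 * (1 + eta (u * s)))"
      using C_bounds p_bounds by (intro mult_left_mono) auto
    then have 1: "C * (a0 - a1 * s + a2 * s^2 - \<gamma>/2 * (1 + eta s))
        \<le> C / p * (\<rho> * (1 + eta s) - u^4 * (1 + eta (u * s)))"
      using p_bounds by simp
    have 2: "C * \<beta> * ((1 - u) / (1 - r * u)) \<le> C * \<beta> * e"
      unfolding e_def using tail_noise_le C_bounds beta_bounds by (intro mult_left_mono) auto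
    have "\<theta> * (\<gamma> * (u^2 * eta (u * s))) \<le> \<theta>0 * (\<gamma> * (u^2 * eta (u * s)))"
      using theta_le gamma_pos eta_nonneg[OF us] by (intro mult_right_mono) auto
    moreover have "\<theta> * H s = \<theta> + \<theta> * (\<gamma> * (u^2 * eta (u * s)))"
      by (simp add: H_eq distrib_left)
    ultimately have 3: "\<theta> * H s \<le> \<theta>0 - \<gamma> * (9/20 * p * (1 + 1/2 * p)) + \<theta>0 * (\<gamma> * (u^2 * eta (u * s)))"
      using theta_eq by argo
    have "F0 + F1 * \<gamma> = C * (a0 - a1 * s + a2 * s^2 - \<gamma>/2 * (1 + eta s))
        - 2 * (\<theta>0 - \<gamma> * (9/20 * p * (1 + 1/2 * p)) + \<theta>0 * (\<gamma> * (u^2 * eta (u * s)))) - C * \<beta> * e"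
      unfolding F0_def F1_def by algebra
    then show ?thesis using 1 2 3 by (simp add: X_def)
  qed
  moreover have "0 \<le> F0 + F1 * \<gamma>"
  proof (rule affine_nonneg)
    \<comment> \<open>The end points are polynomials in \<open>u\<close>, written in Bernstein form with nonnegative coefficients.\<close>
    have "0 \<le> (C * a0 - 2 * \<theta>0 - C * \<beta> * e) + (- C * a1) * s + (C * a2) * s^2"
    proof (rule quadratic_nonneg_by_tangent[where t = 1])
      show "0 \<le> C * a2" using C_bounds by (simp add: a2_def)
      have eq: "C * a0 - 2 * \<theta>0 - C * \<beta> * e - C * a2 = 9/20 * (1 - u)^5 + 337/250 * u * (1 - u)^4 + 1227/500 * u^2 * (1 - u)^3 + 18/5 * u^3 *
      (1 - u)^2 + 1121/500 * u^4 * (1 - u) + 189/500 * u^5"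
        unfolding C_def a0_def \<theta>0_def \<beta>_def e_def a2_def by algebra
      have "0 \<le> C * a0 - 2 * \<theta>0 - C * \<beta> * e - C * a2" unfolding eq using u_nonneg u_le
        by (intro add_nonneg_nonneg mult_nonneg_nonneg zero_le_power) auto
      then show "0 \<le> C * a0 - 2 * \<theta>0 - C * \<beta> * e - C * a2 * 1^2" by simp
      have eq: "C * a0 - 2 * \<theta>0 - C * \<beta> * e + (- C * a1) + C * a2 = 1/5 * (1 - u)^6 + 179/500 * u * (1 - u)^5 + 51/500 * u^2 * (1 - u)^4 + 357/500 * u^3 *
      (1 - u)^3 + 561/500 * u^4 * (1 - u)^2 + 207/200 * u^5 * (1 - u) + 473/1000 * u^6"
        unfolding C_def a0_def \<theta>0_def \<beta>_def e_def a1_def a2_def by algebra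
      have "0 \<le> C * a0 - 2 * \<theta>0 - C * \<beta> * e + (- C * a1) + C * a2"
        unfolding eq using u_nonneg u_le
        by (intro add_nonneg_nonneg mult_nonneg_nonneg zero_le_power) auto
      then show "0 \<le> C * a0 - 2 * \<theta>0 - C * \<beta> * e + (- C * a1) + C * a2 * (2 * 1 - 1^2)"
        by simp
    qed (use assms in auto)
    then show "0 \<le> F0" by (simp add: F0_def algebra_simps)
    define K where "K = C * (a0 - 1) - 2 * \<theta>0 * (1 + u^2) - C * \<beta> * e + 9/10 * p * (1 + 1/2 * p)"
    define Q1 where "Q1 = 2 * \<theta>0 * (7/4 * u^3) - C * (a1 - 7/8)"
    define Q2 where "Q2 = C * (a2 - 3/8) - 2 * \<theta>0 * (3/4 * u^4)"
    have "0 \<le> K + Q1 * s + Q2 * s^2"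
    proof (rule quadratic_nonneg_by_tangent[where t = "3/4"])
      have eq: "Q2 = 3/8 * (1 - u)^7 + 507/200 * u * (1 - u)^6 + 1617/200 * u^2 * (1 - u)^5 + 3069/200 *
      u^3 * (1 - u)^4 + 3681/200 * u^4 * (1 - u)^3 + 2643/200 * u^5 * (1 - u)^2 + 981/200 *
      u^6 * (1 - u) + 33/40 * u^7"
        unfolding Q2_def C_def \<theta>0_def a2_def by algebra
      show "0 \<le> Q2" unfolding eq using u_nonneg u_le
        by (intro add_nonneg_nonneg mult_nonneg_nonneg zero_le_power) auto
      have eq: "K - Q2 * (3/4)^2 = 857/640 * (1 - u)^7 + 137313/16000 * u * (1 - u)^6 + 73159/3200 * u^2 * (1 - u)^5 +
      505511/16000 * u^3 * (1 - u)^4 + 368371/16000 * u^4 * (1 - u)^3 + 129097/16000 * u^5 *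
      (1 - u)^2 + 18703/16000 * u^6 * (1 - u) + 1023/16000 * u^7"
        unfolding K_def Q2_def p_def C_def a0_def \<theta>0_def \<beta>_def e_def a2_def
        by algebra
      show "0 \<le> K - Q2 * (3/4)^2" unfolding eq using u_nonneg u_le
        by (intro add_nonneg_nonneg mult_nonneg_nonneg zero_le_power) auto
      have eq: "K + Q1 + Q2 * (2 * (3/4) - (3/4)^2) = 657/640 * (1 - u)^7 + 103513/16000 * u * (1 - u)^6 + 51599/3200 * u^2 * (1 - u)^5 +
      317711/16000 * u^3 * (1 - u)^4 + 190171/16000 * u^4 * (1 - u)^3 + 45297/16000 * u^5 *
      (1 - u)^2 + 343/16000 * u^6 * (1 - u) + 663/16000 * u^7"
        unfolding K_def Q1_def Q2_def p_def C_def a0_def \<theta>0_def \<beta>_def e_def a1_def a2_def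
        by algebra
      show "0 \<le> K + Q1 + Q2 * (2 * (3/4) - (3/4)^2)" unfolding eq using u_nonneg u_le
        by (intro add_nonneg_nonneg mult_nonneg_nonneg zero_le_power) auto
    qed (use assms in auto)
    moreover have "F0 + F1 = K + Q1 * s + Q2 * s^2"
      unfolding F0_def F1_def K_def Q1_def Q2_def eta_def by algebra
    ultimately show "0 \<le> F0 + F1" by simp
  qed (use gamma_pos gamma_le in auto)
  ultimately have "0 \<le> s^2 * X" by simp
  moreover have "\<rho> * c s - (u^2 * c (u * s) + 2 * s * \<Theta> s + C * s * (1 - u) * (\<beta> * s / (1 - r * u))) = s^2 * X"
    unfolding c_def \<Theta>_def X_def by algebra
  ultimately show ?thesis by linarith
qed

text \<open>The noise left on the gap at \<open>x\<close> is made affine in \<open>s\<close> for the corner argument of the next lemma.\<close>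

lemma step_Gamma_le:
  assumes "0 \<le> s" "s \<le> 1"
  shows "s * \<Gamma> s \<le> 2/5 + 7/4 * s"
proof -
  define X where "X = u^3 - 9/20 * (1 + u^2)"
  have us: "0 \<le> u * s" "u * s \<le> 1" using us_bounds[OF assms] by auto
  have "\<gamma> * (u^2 * eta (u * s)) \<le> 1 * (u^2 * (1 - u * s))"
    using gamma_pos gamma_le eta_nonneg[OF us] eta_le[OF us] by (intro mult_mono mult_left_mono) auto
  then have H: "H s \<le> 1 + u^2 * (1 - u * s)" by (simp add: H_eq)
  have "\<theta> * s \<le> 9/20 * s" using theta_le theta0_bounds assms by (intro mult_right_mono) auto
  then have "1 + \<theta> * s \<le> 1 + 9/20 * s" by simp
  from mult_mono[OF H this] have "\<Gamma> s \<le> (1 + u^2 * (1 - u * s)) * (1 + 9/20 * s) + 1/2 * p"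
    unfolding Gamma_eq using H_ge[OF assms] theta_pos assms us by simp
  then have "s * \<Gamma> s \<le> s * ((1 + u^2 * (1 - u * s)) * (1 + 9/20 * s) + 1/2 * p)"
    using assms by (intro mult_left_mono)
  also have "\<dots> = 2/5 + 7/4 * s - (2/5 + (1/4 - 1/2 * u^2) * s + X * s^2 + 9/20 * u^3 * s^3)"
    unfolding X_def p_def by algebra
  also have "\<dots> \<le> 2/5 + 7/4 * s"
  proof -
    have "0 \<le> 2/5 + (1/4 - 1/2 * u^2 + min X 0) * s"
    proof (rule affine_nonneg)
      have eq: "1/5 - 19/20 * u^2 + u^3 = 1/5 * (1 - u)^5 + 1 * u * (1 - u)^4 + 21/20 * u^2 * (1 - u)^3 + 3/20 * u^3 * (1 - u)^2
      + 3/20 * u^4 * (1 - u) + 1/4 * u^5" by algebra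
      have "0 \<le> 1/5 - 19/20 * u^2 + u^3" unfolding eq using u_nonneg u_le
        by (intro add_nonneg_nonneg mult_nonneg_nonneg zero_le_power) auto
      then have "0 \<le> 2/5 + (1/4 - 1/2 * u^2 + X)" unfolding X_def by argo
      then show "0 \<le> 2/5 + (1/4 - 1/2 * u^2 + min X 0)"
        using u_sq(2) by (simp add: min_def)
    qed (use assms in auto)
    moreover have "min X 0 * s \<le> X * s^2"
    proof (cases "X \<le> 0")
      case True
      have "s^2 \<le> s" using assms by (simp add: power2_eq_square mult_left_le)
      then show ?thesis using True by (simp add: mult_left_mono_neg)
    qed (use assms in simp)
    moreover have "0 \<le> 9/20 * u^3 * s^3" using u_nonneg assms by simp
    ultimately show ?thesis by (simp add: distrib_right)
  qed
  finally show ?thesis .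
qed

text \<open>Small steps contract \<open>|x - x\<^sup>*|\<^sup>2\<close> by less than \<open>\<rho>\<close>, which the growth of \<open>h\<close> towards \<open>s = 0\<close>
  compensates: \<open>h\<close> anticipates the next reset. The contraction comes from two sources: \<open>m s H\<close> from strong convexity, and the leftover
  \<open>s S\<close> times the gap at \<open>x\<close>, which is at least \<open>(m/2) |x - x\<^sup>*|\<^sup>2\<close>.
  After division by \<open>\<gamma> p s\<close> the slack \<open>Z\<close> is bounded below by an expression that is affine in \<open>\<gamma>\<close>
  and in \<open>s\<close>, which leaves four corner polynomials in \<open>u\<close>.\<close>

lemma h_contraction:
  assumes "0 \<le> s" "s \<le> 1"
  shows "H s * (1 - m * s) - s * S s * m / 2 \<le> \<rho> * h s"
proof -
  define A where "A = 1 + u^2 - 1/2 * u^3 - 1/2 * \<gamma>"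
  define B where "B = 1 + u^2 - 1/2 * \<gamma>"
  define y where "y = 2/5 + 7/4 * s"
  define E where "E = 1 - 7/4 * u * s + 3/4 * u^2 * (6/5 * s - 9/25)"
  define Z where "Z = 3/2 * H s - 3/8 * C * (u + \<omega>) - 3/8 * m * (s * \<Gamma> s)
    - 7/4 * A + 3/4 * s * B + 1/2 * (1 - \<gamma>) * (10/3 - 25/9 * s)"
  define Z0 where "Z0 = 3/2 - 3/8 * C * (3/2 * u + 9/8 * (1 - u)) - 3/8 * (2/7 * (1 - u)) * y
    - 7/4 * (1 + u^2 - 1/2 * u^3) + 3/4 * s * (1 + u^2) + 1/2 * (10/3 - 25/9 * s)"
  define Z1 where "Z1 = 3/2 * u^2 * E - 3/16 * C * u - 9/32 * u * p * y
    + 7/8 - 3/8 * s - 1/2 * (10/3 - 25/9 * s)"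
  have us: "0 \<le> u * s" "u * s \<le> 1" using us_bounds[OF assms] by auto
  have "Z0 + Z1 * \<gamma> \<le> Z"
  proof -
    have "0 \<le> 3/4 * u^2 * (s - 3/5)^2" by simp
    moreover have "eta (u * s) - E = 3/4 * u^2 * (s - 3/5)^2" unfolding eta_def E_def by algebra
    ultimately have "E \<le> eta (u * s)" by argo
    then have "\<gamma> * (u^2 * E) \<le> \<gamma> * (u^2 * eta (u * s))"
      using gamma_pos by (intro mult_left_mono) auto
    then have 1: "3/2 * (1 + \<gamma> * (u^2 * E)) \<le> 3/2 * H s" by (simp add: H_eq)
    have 2: "3/8 * C * (u + \<omega>) \<le> 3/8 * C * (u + (1/2 * u * (1 + \<gamma>) + 9/8 * (1 - u)))"
      using omega_le C_bounds by (intro mult_left_mono) auto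
    \<comment> \<open>Close to \<open>u = 1\<close> the bound \<open>m \<le> 3\<gamma>p/4\<close> is the better one, for small \<open>u\<close> it is \<open>m \<le> 2/7\<close>; the weights \<open>u\<close> and \<open>1 - u\<close> combine them.\<close>
    have "u * m + (1 - u) * m \<le> u * m + (1 - u) * (2/7)"
      using m_bounds u_le by (intro add_left_mono mult_left_mono) auto
    then have m: "m \<le> u * m + 2/7 * (1 - u)" by (simp add: algebra_simps)
    have "m * (s * \<Gamma> s) \<le> (u * m + 2/7 * (1 - u)) * y"
      unfolding y_def using m step_Gamma_le[OF assms] Gamma_nonneg[OF assms] m_bounds assms u_nonneg u_le
      by (intro mult_mono) auto
    from mult_left_mono[OF this, of "3/8"]
    have 3: "3/8 * m * (s * \<Gamma> s) \<le> 3/8 * ((u * m + 2/7 * (1 - u)) * y)"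
      by (simp only: mult.assoc)
    have "Z0 + Z1 * \<gamma> = 3/2 * (1 + \<gamma> * (u^2 * E)) - 3/8 * C * (u + (1/2 * u * (1 + \<gamma>) + 9/8 * (1 - u)))
        - 3/8 * ((u * m + 2/7 * (1 - u)) * y) - 7/4 * A + 3/4 * s * B + 1/2 * (1 - \<gamma>) * (10/3 - 25/9 * s)"
      unfolding Z0_def Z1_def A_def B_def m_def by algebra
    then show ?thesis using 1 2 3 unfolding Z_def by argo
  qed
  moreover have "0 \<le> Z0 + Z1 * \<gamma>"
  proof (rule affine_nonneg)
    define z0 where "z0 = 3/2 - 3/8 * C * (3/2 * u + 9/8 * (1 - u)) - 3/8 * (2/7 * (1 - u)) * (2/5)
      - 7/4 * (1 + u^2 - 1/2 * u^3) + 5/3"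
    define z1 where "z1 = - 3/8 * (2/7 * (1 - u)) * (7/4) + 3/4 * (1 + u^2) - 25/18"
    have "0 \<le> z0 + z1 * s"
    proof (rule affine_nonneg)
      have eq: "z0 = 6397/6720 * (1 - u)^3 + 4003/1400 * u * (1 - u)^2 + 12841/11200 * u^2 * (1 - u) +
      137/1200 * u^3"
        unfolding z0_def C_def by algebra
      show "0 \<le> z0" unfolding eq using u_nonneg u_le
        by (intro add_nonneg_nonneg mult_nonneg_nonneg zero_le_power) auto
      have eq: "z0 + z1 = 2531/20160 * (1 - u)^4 + 69871/100800 * u * (1 - u)^3 + 2419/6720 * u^2 * (1 - u)^2 +
      1777/100800 * u^3 * (1 - u) + 811/3600 * u^4"
        unfolding z0_def z1_def C_def by algebra
      show "0 \<le> z0 + z1" unfolding eq using u_nonneg u_le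
        by (intro add_nonneg_nonneg mult_nonneg_nonneg zero_le_power) auto
    qed (use assms in auto)
    moreover have "Z0 = z0 + z1 * s" unfolding Z0_def z0_def z1_def y_def by algebra
    ultimately show "0 \<le> Z0" by simp
    define x0 where "x0 = z0 + 3/2 * u^2 * (1 - 27/100 * u^2) - 3/16 * C * u - 9/32 * u * p * (2/5) + 7/8 - 5/3"
    define x1 where "x1 = z1 + 3/2 * u^2 * (9/10 * u^2 - 7/4 * u) - 9/32 * u * p * (7/4) - 3/8 + 25/18"
    have "0 \<le> x0 + x1 * s"
    proof (rule affine_nonneg)
      have eq: "x0 = 359/2240 * (1 - u)^5 + 2827/5600 * u * (1 - u)^4 + 687/2800 * u^2 * (1 - u)^3 +
      333/1120 * u^3 * (1 - u)^2 + 7521/11200 * u^4 * (1 - u) + 11/40 * u^5"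
        unfolding x0_def z0_def C_def p_def by algebra
      show "0 \<le> x0" unfolding eq using u_nonneg u_le
        by (intro add_nonneg_nonneg mult_nonneg_nonneg zero_le_power) auto
      have eq: "x0 + x1 = 779/2240 * (1 - u)^8 + 6979/3200 * u * (1 - u)^7 + 3909/640 * u^2 * (1 - u)^6 +
      14683/1600 * u^3 * (1 - u)^5 + 5761/800 * u^4 * (1 - u)^4 + 7471/3200 * u^5 * (1 -
      u)^3 + 33/3200 * u^6 * (1 - u)^2 + 279/2800 * u^7 * (1 - u) + 1/8 * u^8"
        unfolding x0_def x1_def z0_def z1_def C_def p_def by algebra
      show "0 \<le> x0 + x1" unfolding eq using u_nonneg u_le
        by (intro add_nonneg_nonneg mult_nonneg_nonneg zero_le_power) auto
    qed (use assms in auto)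
    moreover have "Z0 + Z1 = x0 + x1 * s"
      unfolding Z0_def Z1_def x0_def x1_def z0_def z1_def y_def E_def by algebra
    ultimately show "0 \<le> Z0 + Z1" by simp
  qed (use gamma_pos gamma_le in auto)
  ultimately have "0 \<le> \<gamma> * p * s * Z" using gamma_pos p_bounds assms by simp
  \<comment> \<open>The last square comes from replacing the constant \<open>1\<close> by its tangent bound \<open>(10/3) s - (25/9) s\<^sup>2\<close> at \<open>s = 3/5\<close>, so that \<open>s\<close> can be factored out.\<close>
  moreover have "\<rho> * h s - (H s * (1 - m * s) - s * S s * m / 2)
      = \<gamma> * p * s * Z + 7/4 * \<gamma> * s * (p * A - (\<rho> - u^3))
        + 1/2 * \<gamma> * p * (1 - \<gamma>) * (1 - 5/3 * s)^2"
    unfolding Z_def S_def A_def B_def m_def H_eq h_def \<rho>_def p_def eta_def by algebra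
  moreover have "0 \<le> 7/4 * \<gamma> * s * (p * A - (\<rho> - u^3))"
  proof -
    have "p * A - (\<rho> - u^3) = 1/2 * u^3 * (1 - u)^2"
      unfolding p_def A_def \<rho>_def by algebra
    moreover have "0 \<le> 7/4 * \<gamma> * s * (1/2 * u^3 * (1 - u)^2)"
      using gamma_pos assms u_nonneg by simp
    ultimately show ?thesis by (simp only:)
  qed
  moreover have "0 \<le> 1/2 * \<gamma> * p * (1 - \<gamma>) * (1 - 5/3 * s)^2"
    using gamma_pos gamma_le p_bounds by simp
  ultimately show ?thesis by argo
qed

end

lemma svrg_rates_interpretation:
  assumes "0 \<le> u" "u < 1" "0 < \<gamma>" "\<gamma> \<le> 1" "3/4 * \<gamma> * (1 - u^2) \<le> scaled_step u"
  shows "svrg_rates u \<gamma> (scaled_step u)"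
  using assms scaled_step_lower[of u] scaled_step_upper[of u] by unfold_locales auto

section \<open>Decrease of the Lyapunov function\<close>

lemma batch_mean_sq_dist:
  fixes g :: "nat set \<Rightarrow> 'a::real_inner"
  assumes "b \<le> n"
  shows "batch_mean n b (\<lambda>B. (norm (x - s *\<^sub>R g B - y))\<^sup>2)
    = (norm (x - y))\<^sup>2 - 2 * s * (batch_mean n b g \<bullet> (x - y)) + s\<^sup>2 * batch_mean n b (\<lambda>B. (norm (g B))\<^sup>2)"
proof -
  have "(norm (x - s *\<^sub>R g B - y))\<^sup>2 = (norm (x - y))\<^sup>2 - (2 * s) * ((x - y) \<bullet> g B) + s\<^sup>2 * (norm (g B))\<^sup>2" for B
    unfolding power2_norm_eq_inner
    by (simp add: inner_diff_left inner_diff_right inner_commute power2_eq_square algebra_simps)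
  then show ?thesis
    by (simp only: batch_mean_add batch_mean_diff batch_mean_cmult batch_mean_inner batch_mean_const[OF assms]
        inner_commute[of "batch_mean n b g"])
qed

text \<open>An estimator \<open>g\<close> of a gradient \<open>G\<close> of the gap function \<open>D\<close>, with reference point \<open>w\<close>. Gap, gradient and
  estimator are meant to be multiplied by \<open>\<alpha>\<close>, so that steps have length \<open>s \<le> 1\<close> and the constants are
  \<open>\<kappa>\<close> and \<open>m\<close>.\<close>

locale variance_reduced = svrg_rates +
  fixes n b :: nat
    and g :: "nat set \<Rightarrow> 'a::euclidean_space \<Rightarrow> 'a \<Rightarrow> 'a"
    and D :: "'a \<Rightarrow> real" and G :: "'a \<Rightarrow> 'a" and xs :: 'a
  assumes b_le: "b \<le> n"
    and mean: "batch_mean n b (\<lambda>B. g B x w) = G x"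
    and second_moment: "batch_mean n b (\<lambda>B. (norm (g B x w))\<^sup>2)
      \<le> (2 * \<kappa> - m) * (D w + G x \<bullet> (x - w)) + m * D x"
    and tangent: "D x + G x \<bullet> (y - x) \<le> D y"
    and growth: "m / 2 * (norm (x - xs))\<^sup>2 \<le> D x"
    and strong: "D x + m / 2 * (norm (x - xs))\<^sup>2 \<le> G x \<bullet> (x - xs)"
begin

lemma D_nonneg: "0 \<le> D x"
  using growth[of x] m_bounds by (meson mult_nonneg_nonneg order_trans zero_le_power2 divide_nonneg_nonneg zero_le_numeral)

lemma le_cross: "D x \<le> D w + G x \<bullet> (x - w)"
  using tangent[of x w] by (simp add: inner_diff_right)

lemma second_moment':
  "batch_mean n b (\<lambda>B. (norm (g B x w))\<^sup>2) \<le> 2 * \<kappa> * (D w + G x \<bullet> (x - w))"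
  using second_moment[of x w] mult_left_mono[OF le_cross[of x w], of m] m_bounds
  by (simp add: algebra_simps)

text \<open>Recursion at the front of the trajectory, with the step size in the state. It is the form in
  which the potential can depend on the number of remaining steps.\<close>

primrec expected_dist :: "nat \<Rightarrow> 'a \<Rightarrow> 'a \<Rightarrow> real \<Rightarrow> real" where
  "expected_dist 0 x w s = (norm (x - xs))\<^sup>2"
| "expected_dist (Suc k) x w s = batch_mean n b (\<lambda>B.
     p * expected_dist k (x - s *\<^sub>R g B x w) x 1
     + u^2 * expected_dist k (x - s *\<^sub>R g B x w) w (u * s))"

text \<open>The discounted gaps along the trajectory that is never reset. They are the gaps that future
  resets will move to the reference point: a toss succeeds after \<open>j\<close> failures with probability
  \<open>p (1-p)\<^sup>j\<close>, and the discount by \<open>\<rho>\<close> accounts for the contraction required meanwhile.\<close>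

primrec tail :: "nat \<Rightarrow> 'a \<Rightarrow> 'a \<Rightarrow> real \<Rightarrow> real" where
  "tail 0 x w s = 0"
| "tail (Suc k) x w s = D x + r * batch_mean n b (\<lambda>B. tail k (x - s *\<^sub>R g B x w) w (u * s))"

text \<open>Stochastic gradient descent compared with an arbitrary point \<open>y\<close>. Dividing the recursion of
  \<open>|x - y|\<^sup>2\<close> by twice the step size gives \<open>D x - D y\<close> in each step, and the coefficients \<open>r\<^sup>j/u\<^sup>j\<close>
  thus put on \<open>|x - y|\<^sup>2\<close> are nonincreasing since \<open>r \<le> u\<close>. Therefore the gaps along the whole tail
  are paid for by \<open>D y\<close> and a multiple of the noise, which the drift of \<open>|x - w|\<^sup>2\<close> turns into
  \<open>D w\<close>. One step lowers the coefficient of \<open>|x - y|\<^sup>2\<close> from \<open>u/(2rs)\<close> to \<open>1/(2s)\<close>.\<close>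

lemma tail_le_comparator:
  assumes u: "0 < u" and s: "0 < s" "s \<le> 1"
  shows "tail k x w s \<le> D y / (1 - r) + u / (2 * r * s) * (norm (x - y))\<^sup>2
    + \<beta> / 2 * (norm (x - w))\<^sup>2 + \<beta> * s / (1 - r * u) * D w"
  using s
proof (induction k arbitrary: x w s)
  case 0
  then show ?case
    using D_nonneg r_bounds u ru_less beta_bounds by (auto intro!: add_nonneg_nonneg mult_nonneg_nonneg divide_nonneg_nonneg)
next
  case (Suc k)
  have r0: "0 < r" using u rho_bounds by (simp add: r_def)
  have us: "0 < u * s" "u * s \<le> 1" using u Suc.prems us_bounds[of s] by auto
  define M where "M = batch_mean n b (\<lambda>B. (norm (g B x w))\<^sup>2)"
  define X where "X = D w + G x \<bullet> (x - w)"
  have X0: "0 \<le> X" using le_cross[of x w] D_nonneg[of x] by (simp add: X_def)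
  have M: "M \<le> 2 * \<kappa> * X" using second_moment' by (simp add: M_def X_def)
  define x' where "x' B = x - s *\<^sub>R g B x w" for B
  have dist: "batch_mean n b (\<lambda>B. (norm (x' B - z))\<^sup>2) = (norm (x - z))\<^sup>2 - 2 * s * (G x \<bullet> (x - z)) + s\<^sup>2 * M" for z
    unfolding x'_def M_def using batch_mean_sq_dist[OF b_le, of x s "\<lambda>B. g B x w" z] by (simp add: mean)
  have "batch_mean n b (\<lambda>B. tail k (x' B) w (u * s))
    \<le> batch_mean n b (\<lambda>B. D y / (1 - r) + u / (2 * r * (u * s)) * (norm (x' B - y))\<^sup>2
        + \<beta> / 2 * (norm (x' B - w))\<^sup>2 + \<beta> * (u * s) / (1 - r * u) * D w)"
    by (intro batch_mean_mono Suc.IH us)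
  also have "\<dots> = D y / (1 - r) + u / (2 * r * (u * s)) * ((norm (x - y))\<^sup>2 - 2 * s * (G x \<bullet> (x - y)) + s\<^sup>2 * M)
      + \<beta> / 2 * ((norm (x - w))\<^sup>2 - 2 * s * (G x \<bullet> (x - w)) + s\<^sup>2 * M) + \<beta> * (u * s) / (1 - r * u) * D w"
    by (simp only: batch_mean_add batch_mean_cmult batch_mean_const[OF b_le] dist)
  finally have "r * batch_mean n b (\<lambda>B. tail k (x' B) w (u * s)) \<le> r * (\<dots>)"
    using r0 by (intro mult_left_mono) auto
  then have 1: "tail (Suc k) x w s \<le> D x + r * (D y / (1 - r))
      + (r * (u / (2 * r * (u * s)))) * ((norm (x - y))\<^sup>2 - 2 * s * (G x \<bullet> (x - y)) + s\<^sup>2 * M)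
      + r * (\<beta> / 2 * ((norm (x - w))\<^sup>2 - 2 * s * (G x \<bullet> (x - w)) + s\<^sup>2 * M))
      + r * (\<beta> * (u * s) / (1 - r * u) * D w)"
    by (simp add: x'_def[symmetric] distrib_left mult.assoc)
  have 2: "r * (u / (2 * r * (u * s))) = 1 / (2 * s)" using r0 u Suc.prems by simp
  have "(1 / (2 * s)) * ((norm (x - y))\<^sup>2 - 2 * s * (G x \<bullet> (x - y)) + s\<^sup>2 * M)
      = (norm (x - y))\<^sup>2 / (2 * s) - G x \<bullet> (x - y) + s / 2 * M"
    using Suc.prems by (simp add: field_simps power2_eq_square)
  moreover have "(norm (x - y))\<^sup>2 / (2 * s) \<le> u / (2 * r * s) * (norm (x - y))\<^sup>2"
  proof -
    have "1 / (2 * s) \<le> u / (2 * r * s)" using r0 r_bounds Suc.prems by (simp add: field_simps)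
    from mult_right_mono[OF this, of "(norm (x - y))\<^sup>2"] show ?thesis by simp
  qed
  moreover have "D x - D y \<le> G x \<bullet> (x - y)" using tangent[of x y] by (simp add: inner_diff_right)
  ultimately have 3: "(1 / (2 * s)) * ((norm (x - y))\<^sup>2 - 2 * s * (G x \<bullet> (x - y)) + s\<^sup>2 * M)
      \<le> u / (2 * r * s) * (norm (x - y))\<^sup>2 - (D x - D y) + s / 2 * M" by linarith
  have "0 \<le> \<beta> / 2 * ((norm (x - w))\<^sup>2 - 2 * s * (G x \<bullet> (x - w)) + s\<^sup>2 * M)"
    unfolding dist[symmetric] using beta_bounds batch_mean_mono[of "\<lambda>_. 0" "\<lambda>B. (norm (x' B - w))\<^sup>2" n b]
    by (simp add: batch_mean_const[OF b_le])
  then have 4: "r * (\<beta> / 2 * ((norm (x - w))\<^sup>2 - 2 * s * (G x \<bullet> (x - w)) + s\<^sup>2 * M))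
      \<le> \<beta> / 2 * ((norm (x - w))\<^sup>2 - 2 * s * (G x \<bullet> (x - w)) + s\<^sup>2 * M)"
    using r_bounds by (intro mult_left_le_one_le) auto
  have 5: "s / 2 * M + \<beta> / 2 * (s\<^sup>2 * M) \<le> \<beta> * s * X"
  proof -
    have "\<kappa> * (1 + \<beta> * s) \<le> \<kappa> * (1 + \<beta>)"
      using Suc.prems beta_bounds kappa_lower by (intro mult_left_mono) auto
    then have "s * X * (\<kappa> * (1 + \<beta> * s)) \<le> s * X * \<beta>"
      using kappa_le_beta Suc.prems X0 by (intro mult_left_mono) auto
    moreover have "s / 2 * (1 + \<beta> * s) * M \<le> s / 2 * (1 + \<beta> * s) * (2 * \<kappa> * X)"
      using M Suc.prems beta_bounds by (intro mult_left_mono) auto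
    ultimately show ?thesis by (simp add: algebra_simps power2_eq_square)
  qed
  have 6: "D y + r * (D y / (1 - r)) = D y / (1 - r)" using r_bounds by (simp add: field_simps)
  have 7: "\<beta> * s * D w + r * (\<beta> * (u * s) / (1 - r * u) * D w) = \<beta> * s / (1 - r * u) * D w"
    using ru_less by (simp add: field_simps)
  have 8: "\<beta> / 2 * ((norm (x - w))\<^sup>2 - 2 * s * (G x \<bullet> (x - w)) + s\<^sup>2 * M)
      = \<beta> / 2 * (norm (x - w))\<^sup>2 - \<beta> * s * X + \<beta> * s * D w + \<beta> / 2 * (s\<^sup>2 * M)"
    by (simp add: X_def algebra_simps)
  show ?case using 1 3 4 5 6 7 8 unfolding 2 by linarith
qed

text \<open>The comparator \<open>y = x\<close>: the gap on the rest of the trajectory is on average not larger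
  than the present one, up to noise. For \<open>u = 0\<close> the tail has a single term.\<close>

lemma tail_le:
  assumes "0 < s" "s \<le> 1"
  shows "tail k x w s \<le> D x / (1 - r) + \<beta> / 2 * (norm (x - w))\<^sup>2 + \<beta> * s / (1 - r * u) * D w"
proof (cases "u = 0")
  case True
  then have "r = 0" using r_bounds(1,3) by simp
  then have "tail k x w s \<le> D x / (1 - r)" using D_nonneg by (cases k) auto
  moreover have "0 \<le> \<beta> / 2 * (norm (x - w))\<^sup>2" "0 \<le> \<beta> * s / (1 - r * u) * D w"
    using beta_bounds assms D_nonneg ru_less by auto
  ultimately show ?thesis by linarith
next
  case False
  then show ?thesis using tail_le_comparator[of s k x w x] u_nonneg assms by simp
qed

definition potential :: "nat \<Rightarrow> 'a \<Rightarrow> 'a \<Rightarrow> real \<Rightarrow> real" where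
  "potential k x w s = h s * (norm (x - xs))\<^sup>2 + wt s * (norm (x - w))\<^sup>2 + c s * D w
     + C / \<rho> * (1 - s) * tail k x w s"

text \<open>The tail sum enters with a weight that increases by \<open>C s (1 - u)/\<rho>\<close> in a failed toss. The increase
  is paid for by the present gap via \<open>tail_le\<close>, at a price proportional to \<open>s\<close> like the gain \<open>2 s D x\<close>
  of the step itself, while the weight already accumulated releases \<open>C (1 - u s) D x\<close>, and this
  covers the cost \<open>C D x\<close> of a possible reset up to a term that is proportional to \<open>s\<close> too.\<close>

lemma potential_step:
  assumes s: "0 < s" "s \<le> 1"
  shows "batch_mean n b (\<lambda>B. p * potential k (x - s *\<^sub>R g B x w) x 1
      + u^2 * potential k (x - s *\<^sub>R g B x w) w (u * s)) \<le> \<rho> * potential (Suc k) x w s"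
proof -
  define M where "M = batch_mean n b (\<lambda>B. (norm (g B x w))\<^sup>2)"
  define X where "X = D w + G x \<bullet> (x - w)"
  define R where "R = (norm (x - xs))\<^sup>2"
  define Q where "Q = (norm (x - w))\<^sup>2"
  define R' where "R' = R - 2 * s * (G x \<bullet> (x - xs)) + s\<^sup>2 * M"
  define Q' where "Q' = Q - 2 * s * (G x \<bullet> (x - w)) + s\<^sup>2 * M"
  define T where "T = tail (Suc k) x w s"
  define x' where "x' B = x - s *\<^sub>R g B x w" for B
  define T' where "T' = batch_mean n b (\<lambda>B. tail k (x' B) w (u * s))"
  have X0: "0 \<le> X" using le_cross[of x w] D_nonneg[of x] by (simp add: X_def)
  have dist: "batch_mean n b (\<lambda>B. (norm (x' B - z))\<^sup>2) = (norm (x - z))\<^sup>2 - 2 * s * (G x \<bullet> (x - z)) + s\<^sup>2 * M" for z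
    unfolding x'_def M_def using batch_mean_sq_dist[OF b_le, of x s "\<lambda>B. g B x w" z] by (simp add: mean)
  have nonneg: "0 \<le> batch_mean n b (\<lambda>B. (norm (z B))\<^sup>2)" for z :: "nat set \<Rightarrow> 'a"
    using batch_mean_mono[of "\<lambda>_. 0" "\<lambda>B. (norm (z B))\<^sup>2" n b] by (simp add: batch_mean_const[OF b_le])
  have M0: "0 \<le> M" unfolding M_def by (rule nonneg)
  have Q0: "0 \<le> Q'" unfolding Q'_def Q_def dist[symmetric] by (rule nonneg)
  have H0: "1 \<le> H s" using H_ge s by simp
  have G0: "0 \<le> \<Gamma> s" using Gamma_nonneg s by simp
  have "batch_mean n b (\<lambda>B. p * potential k (x' B) x 1 + u^2 * potential k (x' B) w (u * s))
      = p * (h 1 * R' + wt 1 * (s\<^sup>2 * M) + c 1 * D x)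
        + u^2 * (h (u * s) * R' + wt (u * s) * Q' + c (u * s) * D w + C / \<rho> * (1 - u * s) * T')"
    by (simp only: potential_def batch_mean_add batch_mean_cmult batch_mean_const[OF b_le] dist
        R'_def Q'_def R_def Q_def T'_def) simp
  also have "\<dots> = H s * R' + p * wt 1 * (s\<^sup>2 * M) + C * D x + u^2 * wt (u * s) * Q'
      + u^2 * c (u * s) * D w + C * (1 - u * s) * (T - D x)"
  proof -
    have h1: "h 1 = 1" "p * c 1 = C" using p_bounds by (auto simp: h_def c_def eta_def)
    have T1: "T - D x = r * T'" by (simp add: T_def T'_def x'_def)
    have u2: "u^2 / \<rho> = r" by (simp add: r_def)
    have "u^2 * (C / \<rho> * (1 - u * s) * T') = C * (1 - u * s) * (u^2 / \<rho> * T')" by simp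
    then have "u^2 * (C / \<rho> * (1 - u * s) * T') = C * (1 - u * s) * (T - D x)"
      unfolding T1 u2 .
    moreover have "H s * R' = p * R' + u^2 * h (u * s) * R'" by (simp add: H_def distrib_right)
    ultimately show ?thesis using h1 by (simp add: distrib_left mult.assoc[symmetric])
  qed
  also have "\<dots> \<le> H s * R - 2 * s * H s * (D x + m / 2 * R) + \<Theta> s * Q + 2 * s * \<Theta> s * D w
      + s\<^sup>2 * \<Gamma> s * m * D x + C * D x + u^2 * c (u * s) * D w + C * (1 - u * s) * (T - D x)"
  proof -
    have 1: "p * wt 1 * (s\<^sup>2 * M) \<le> 1/2 * p * (s\<^sup>2 * M)"
      using wt_one p_bounds M0 by (intro mult_right_mono) auto
    have 2: "u^2 * wt (u * s) * Q' \<le> \<Theta> s * Q'"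
      using wt_decrease[of s] s Q0 by (intro mult_right_mono) auto
    have "2 * s * H s * (D x + m / 2 * R) \<le> 2 * s * H s * (G x \<bullet> (x - xs))"
      unfolding R_def using strong s H0 by (intro mult_left_mono) auto
    moreover have "s\<^sup>2 * \<Gamma> s * M \<le> s\<^sup>2 * \<Gamma> s * ((2 * \<kappa> - m) * X + m * D x)"
      unfolding M_def X_def using second_moment G0 by (intro mult_left_mono) auto
    moreover have "2 * s * (s * (\<kappa> - m/2) * \<Gamma> s) * X \<le> 2 * s * \<Theta> s * X"
      using Theta_dominates[of s] s X0 by (intro mult_right_mono mult_left_mono) auto
    moreover have "s\<^sup>2 * \<Gamma> s * ((2 * \<kappa> - m) * X + m * D x)
        = 2 * s * (s * (\<kappa> - m/2) * \<Gamma> s) * X + s\<^sup>2 * \<Gamma> s * m * D x"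
      by (simp add: algebra_simps power2_eq_square)
    moreover have "H s * R' + 1/2 * p * (s\<^sup>2 * M) + \<Theta> s * Q'
        = H s * R - 2 * s * H s * (G x \<bullet> (x - xs)) + \<Theta> s * Q - 2 * s * \<Theta> s * X + 2 * s * \<Theta> s * D w
          + s\<^sup>2 * \<Gamma> s * M"
      unfolding R'_def Q'_def X_def \<Gamma>_def by algebra
    ultimately show ?thesis using 1 2 by linarith
  qed
  also have "\<dots> \<le> \<rho> * h s * R + \<rho> * wt s * Q + \<rho> * c s * D w + C * (1 - s) * T"
  proof -
    have "C * s * (1 - u) * T \<le> C * s * (1 - u) * (D x / (1 - r) + \<beta> / 2 * Q + \<beta> * s / (1 - r * u) * D w)"
      unfolding T_def Q_def using C_bounds s u_le by (intro mult_left_mono tail_le[OF s]) auto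
    also have "\<dots> = C * s * \<omega> * D x + (C * s * (1 - u) * \<beta> / 2) * Q + C * s * (1 - u) * (\<beta> * s / (1 - r * u)) * D w"
      by (simp add: \<omega>_def distrib_left)
    finally have 1: "C * s * (1 - u) * T \<le> C * s * \<omega> * D x + (C * s * (1 - u) * \<beta> / 2) * Q
      + C * s * (1 - u) * (\<beta> * s / (1 - r * u)) * D w" .
    have 2: "\<rho> * wt s * Q = \<Theta> s * Q + (C * s * (1 - u) * \<beta> / 2) * Q"
      using rho_bounds by (simp add: wt_def distrib_right)
    have "(u^2 * c (u * s) + 2 * s * \<Theta> s + C * s * (1 - u) * (\<beta> * s / (1 - r * u))) * D w \<le> \<rho> * c s * D w"
      using c_recursion[of s] s D_nonneg by (intro mult_right_mono) auto
    then have 3: "u^2 * c (u * s) * D w + 2 * s * \<Theta> s * D w + C * s * (1 - u) * (\<beta> * s / (1 - r * u)) * D w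
      \<le> \<rho> * c s * D w" by (simp only: distrib_right)
    have "(H s * (1 - m * s) - s * S s * m / 2) * R \<le> \<rho> * h s * R"
      using h_contraction[of s] s by (intro mult_right_mono) (auto simp: R_def)
    then have 4: "H s * R - m * s * H s * R - s * S s * (m / 2 * R) \<le> \<rho> * h s * R"
      by (simp add: algebra_simps)
    have 5: "s * S s * (m / 2 * R) \<le> s * S s * D x"
      unfolding R_def using growth S_nonneg[of s] s by (intro mult_left_mono) auto
    have 6: "s * S s * D x = 2 * s * H s * D x - C * s * u * D x - C * s * \<omega> * D x - s\<^sup>2 * \<Gamma> s * m * D x"
      unfolding S_def by algebra
    have 7: "C * (1 - u * s) * (T - D x) = C * (1 - s) * T + C * s * (1 - u) * T - C * D x + C * s * u * D x"
      by algebra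
    have 8: "2 * s * H s * (D x + m / 2 * R) = 2 * s * H s * D x + m * s * H s * R"
      by algebra
    show ?thesis using 1 2 3 4 5 6 7 8 by linarith
  qed
  also have "\<dots> = \<rho> * potential (Suc k) x w s"
    using rho_bounds by (simp add: potential_def R_def Q_def T_def distrib_left)
  finally show ?thesis by (simp add: x'_def)
qed

theorem expected_dist_le_potential:
  assumes "0 < s" "s \<le> 1"
  shows "expected_dist k x w s \<le> \<rho> ^ k * potential k x w s"
  using assms
proof (induction k arbitrary: x w s)
  case 0
  have "1 * (norm (x - xs))\<^sup>2 \<le> h s * (norm (x - xs))\<^sup>2"
    using 0 gamma_pos eta_nonneg[of s] by (intro mult_right_mono) (auto simp: h_def)
  moreover have "0 \<le> wt s * (norm (x - w))\<^sup>2" "0 \<le> c s * D w"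
    using 0 wt_nonneg[of s] c_nonneg[of s] D_nonneg[of w] by auto
  ultimately show ?case by (simp add: potential_def)
next
  case (Suc k)
  have "expected_dist (Suc k) x w s \<le> batch_mean n b (\<lambda>B. \<rho> ^ k *
      (p * potential k (x - s *\<^sub>R g B x w) x 1 + u^2 * potential k (x - s *\<^sub>R g B x w) w (u * s)))"
    unfolding expected_dist.simps
  proof (rule batch_mean_mono)
    fix B
    let ?x = "x - s *\<^sub>R g B x w"
    have "p * expected_dist k ?x x 1 \<le> p * (\<rho> ^ k * potential k ?x x 1)"
      using Suc.IH[of 1 ?x x] p_bounds by (intro mult_left_mono) auto
    moreover have "u^2 * expected_dist k ?x w (u * s) \<le> u^2 * (\<rho> ^ k * potential k ?x w (u * s))"
    proof (cases "u = 0")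
      case False
      then have "0 < u * s" "u * s \<le> 1" using u_nonneg Suc.prems us_bounds[of s] by auto
      then show ?thesis using Suc.IH by (intro mult_left_mono) auto
    qed simp
    ultimately show "p * expected_dist k ?x x 1 + u^2 * expected_dist k ?x w (u * s)
      \<le> \<rho> ^ k * (p * potential k ?x x 1 + u^2 * potential k ?x w (u * s))"
      by (simp add: algebra_simps)
  qed
  also have "\<dots> = \<rho> ^ k * batch_mean n b (\<lambda>B.
      p * potential k (x - s *\<^sub>R g B x w) x 1 + u^2 * potential k (x - s *\<^sub>R g B x w) w (u * s))"
    by (rule batch_mean_cmult)
  also have "\<dots> \<le> \<rho> ^ k * (\<rho> * potential (Suc k) x w s)"
    using potential_step[OF Suc.prems] rho_bounds by (intro mult_left_mono) auto
  finally show ?case by (simp only: power_Suc mult_ac)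
qed

end

section \<open>The complexity bound\<close>

context finite_sum_problem
begin

text \<open>All quantities are multiplied by \<open>\<alpha>\<close>. Only the part \<open>\<mu>' = m/\<alpha> \<le> \<mu>\<close> of the strong convexity is
  used, so that contraction and step size stay in a fixed relation even if \<open>\<mu>\<close> is large.\<close>

lemma variance_reduced_scaled:
  assumes rates: "svrg_rates u \<gamma> (\<alpha> * \<Lambda>)" and \<alpha>: "0 < \<alpha>" and m: "svrg_rates.m u \<gamma> \<le> \<alpha> * \<mu>"
  shows "variance_reduced u \<gamma> (\<alpha> * \<Lambda>) n b (\<lambda>B x w. \<alpha> *\<^sub>R estimator B x w) (\<lambda>x. \<alpha> * (F x - F xs)) (\<lambda>x. \<alpha> *\<^sub>R grad F x) xs"
proof -
  interpret svrg_rates u \<gamma> "\<alpha> * \<Lambda>" by (rule rates)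
  define \<mu>' where "\<mu>' = m / \<alpha>"
  have \<mu>': "0 \<le> \<mu>'" "\<mu>' \<le> \<mu>" "m = \<alpha> * \<mu>'"
    using \<alpha> m m_bounds by (auto simp: \<mu>'_def field_simps)
  have strong': "F x \<le> F y + grad F x \<bullet> (x - y) - \<mu>' / 2 * (norm (x - y))\<^sup>2" for x y
    using strongly_convex_mono[OF strong_F \<mu>'(2)] unfolding strongly_convex_with_def by blast
  show ?thesis
  proof unfold_locales
    fix x w y :: 'a
    show "b \<le> n" by (rule b_le)
    show "batch_mean n b (\<lambda>B. \<alpha> *\<^sub>R estimator B x w) = \<alpha> *\<^sub>R grad F x"
      unfolding estimator_mean[of x w, symmetric] batch_mean_def by (simp add: scaleR_sum_right mult.commute)
    have "batch_mean n b (\<lambda>B. (norm (\<alpha> *\<^sub>R estimator B x w))\<^sup>2)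
        = \<alpha>\<^sup>2 * batch_mean n b (\<lambda>B. (norm (estimator B x w))\<^sup>2)"
      by (simp only: norm_scaleR power_mult_distrib power2_abs batch_mean_cmult)
    also have "\<dots> \<le> \<alpha>\<^sup>2 * ((2 * \<Lambda> - \<mu>') * ((F w - F xs) + grad F x \<bullet> (x - w)) + \<mu>' * (F x - F xs))"
      by (intro mult_left_mono estimator_second_moment \<mu>') auto
    also have "\<dots> = (2 * (\<alpha> * \<Lambda>) - m) * (\<alpha> * (F w - F xs) + (\<alpha> *\<^sub>R grad F x) \<bullet> (x - w)) + m * (\<alpha> * (F x - F xs))"
      unfolding \<mu>'(3) by (simp add: power2_eq_square algebra_simps)
    finally show "batch_mean n b (\<lambda>B. (norm (\<alpha> *\<^sub>R estimator B x w))\<^sup>2)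
        \<le> (2 * (\<alpha> * \<Lambda>) - m) * (\<alpha> * (F w - F xs) + (\<alpha> *\<^sub>R grad F x) \<bullet> (x - w)) + m * (\<alpha> * (F x - F xs))" .
    have "\<alpha> * (F x + grad F x \<bullet> (y - x)) \<le> \<alpha> * F y"
      using convex_ge_tangent[OF convex_F GDERIV_grad[OF diff_F]] \<alpha> by (intro mult_left_mono) auto
    then show "\<alpha> * (F x - F xs) + (\<alpha> *\<^sub>R grad F x) \<bullet> (y - x) \<le> \<alpha> * (F y - F xs)"
      by (simp add: algebra_simps)
    have "\<alpha> * (\<mu>' / 2 * (norm (xs - x))\<^sup>2) \<le> \<alpha> * (F x - F xs)"
      using strong'[of xs x] grad_F_minimizer \<alpha> by (intro mult_left_mono) auto
    then show "m / 2 * (norm (x - xs))\<^sup>2 \<le> \<alpha> * (F x - F xs)"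
      by (simp add: \<mu>'(3) norm_minus_commute mult.assoc)
    have "\<alpha> * (F x - F xs + \<mu>' / 2 * (norm (x - xs))\<^sup>2) \<le> \<alpha> * (grad F x \<bullet> (x - xs))"
      using strong'[of x xs] \<alpha> by (intro mult_left_mono) auto
    then show "\<alpha> * (F x - F xs) + m / 2 * (norm (x - xs))\<^sup>2 \<le> (\<alpha> *\<^sub>R grad F x) \<bullet> (x - xs)"
      by (simp add: \<mu>'(3) distrib_left mult.assoc)
  qed
qed

text \<open>The chain is defined by appending steps at the end, \<open>expected_dist\<close> by prepending them; the
  induction moves steps from the one to the other.\<close>

lemma expectation_lsvrgd:
  assumes V: "variance_reduced (sqrt (1 - p)) \<gamma> \<kappa> n b (\<lambda>B x w. \<alpha> *\<^sub>R estimator B x w) D G xs"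
    and p: "0 < p" "p \<le> 1" and \<alpha>: "0 < \<alpha>"
  shows "measure_pmf.expectation (lsvrgd n f b p \<alpha> x0 k) (\<lambda>(x, w, a). (norm (x - xs))\<^sup>2)
    = variance_reduced.expected_dist (sqrt (1 - p)) n b (\<lambda>B x w. \<alpha> *\<^sub>R estimator B x w) xs k x0 x0 1"
proof -
  interpret variance_reduced "sqrt (1 - p)" \<gamma> \<kappa> n b "\<lambda>B x w. \<alpha> *\<^sub>R estimator B x w" D G xs
    by (rule V)
  define val where "val j = (\<lambda>(x, w, a). expected_dist j x w (a / \<alpha>))" for j
  have p_eq: "svrg_rates.p (sqrt (1 - p)) = p" "(sqrt (1 - p))^2 = 1 - p"
    using p unfolding p_def by auto
  have step: "measure_pmf.expectation (lsvrgd_step n f b p \<alpha> st) (val j) = val (Suc j) st" for j st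
  proof -
    obtain x w a where st: "st = (x, w, a)" by (cases st)
    have "val (Suc j) (x, w, a) = batch_mean n b (\<lambda>B. p * val j (x - a *\<^sub>R estimator B x w, x, \<alpha>)
        + (1 - p) * val j (x - a *\<^sub>R estimator B x w, w, sqrt (1 - p) * a))"
      using \<alpha> by (simp only: val_def case_prod_conv expected_dist.simps p_eq) simp
    then show ?thesis unfolding st using p by (simp add: expectation_lsvrgd_step)
  qed
  have "measure_pmf.expectation (lsvrgd n f b p \<alpha> x0 k) (val j) = val (k + j) (x0, x0, \<alpha>)" for j
  proof (induction k arbitrary: j)
    case (Suc k)
    have "measure_pmf.expectation (lsvrgd n f b p \<alpha> x0 (Suc k)) (val j)
        = measure_pmf.expectation (lsvrgd n f b p \<alpha> x0 k) (val (Suc j))"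
      by (simp add: expectation_bind_finite[OF finite_lsvrgd finite_lsvrgd_step] step)
    then show ?case using Suc by simp
  qed simp
  from this[of 0] show ?thesis using \<alpha> by (simp add: val_def case_prod_unfold)
qed

end

theorem corollary5p1:
  fixes f :: "nat \<Rightarrow> 'a::euclidean_space \<Rightarrow> real"
    and Ls :: "nat \<Rightarrow> real" and L \<mu> Lmax p \<alpha> \<epsilon> \<phi>0 :: real
    and n b k :: nat and x0 xstar :: 'a
  assumes "n \<ge> 2"
    and "\<And>i x. i \<in> {1..n} \<Longrightarrow> f i differentiable (at x)"
    and "\<And>i. i \<in> {1..n} \<Longrightarrow> convex_on UNIV (f i)"
    and "\<And>i. i \<in> {1..n} \<Longrightarrow> smooth_with (Ls i) (f i)"
    and "Lmax = Max (Ls ` {1..n})"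
    and "smooth_with L (f_avg n f)"
    and "\<mu> > 0" and "strongly_convex_with \<mu> (f_avg n f)"
    and "\<And>x. f_avg n f xstar \<le> f_avg n f x"
    and "b \<in> {1..n}" and "0 < p" and "p \<le> 1"
    and "\<alpha> = 1 / (2 * zeta_p p * exp_smooth n Lmax L b)"
    and "\<phi>0 = (norm (x0 - xstar))\<^sup>2
           + 8 * \<alpha>\<^sup>2 * exp_smooth n Lmax L b / (p * (3 - 2 * p))
             * (f_avg n f x0 - f_avg n f xstar)"
    and "\<epsilon> > 0"
    and "real k * iteration_cost n b p \<ge> total_complexity n Lmax L \<mu> p b \<epsilon>"
  shows "measure_pmf.expectation (lsvrgd n f b p \<alpha> x0 k)
           (\<lambda>(x, w, a). (norm (x - xstar))\<^sup>2) \<le> \<epsilon> * \<phi>0"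
proof -
  interpret finite_sum_problem f Ls L \<mu> Lmax n b xstar
    using assms by unfold_locales auto
  have p: "0 < p" "p \<le> 1" by fact+
  have \<Lambda>: "0 < \<Lambda>" using mu_pos mu_le_exp_smooth by simp
  define u where "u = sqrt (1 - p)"
  have u: "0 \<le> u" "u < 1" "p = 1 - u^2" using p by (auto simp: u_def)
  have step_eq: "scaled_step u = 1 / (2 * zeta_p p)" using inverse_zeta[OF p] by (simp add: u_def)
  have scaled_step_pos: "0 < scaled_step u" using scaled_step_lower[of u] u by simp
  then have zeta: "0 < zeta_p p" by (simp add: step_eq)
  have \<alpha>: "0 < \<alpha>" "\<alpha> * \<Lambda> = scaled_step u" using \<Lambda> zeta by (auto simp: assms(13) step_eq)
  \<comment> \<open>The contraction per iteration: the complexity is \<open>ln (1/\<epsilon>) / \<delta>\<close> iterations.\<close>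
  define \<delta> where "\<delta> = min (2/3 * \<alpha> * \<mu>) (1/2 * p)"
  define \<gamma> where "\<gamma> = 2 * \<delta> / p"
  have \<delta>: "0 < \<delta>" "\<delta> \<le> 2/3 * \<alpha> * \<mu>" "\<delta> \<le> 1/2 * p" using \<alpha> mu_pos p by (auto simp: \<delta>_def)
  have \<gamma>: "0 < \<gamma>" "\<gamma> \<le> 1" "\<gamma> * p = 2 * \<delta>" using \<delta> p by (auto simp: \<gamma>_def field_simps)
  have m_le: "3/4 * \<gamma> * (1 - u^2) \<le> \<alpha> * \<mu>"
    using \<gamma>(3) \<delta> unfolding u(3)[symmetric] by simp
  have "\<alpha> * \<mu> \<le> scaled_step u"
    unfolding \<alpha>(2)[symmetric] using \<alpha>(1) mu_le_exp_smooth by (intro mult_left_mono) auto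
  then have rates: "svrg_rates u \<gamma> (\<alpha> * \<Lambda>)"
    unfolding \<alpha>(2) using u \<gamma> m_le by (intro svrg_rates_interpretation) auto
  have m_def': "svrg_rates.m u \<gamma> = 3/4 * \<gamma> * (1 - u^2)"
    by (simp add: svrg_rates.m_def[OF rates] svrg_rates.p_def[OF rates])
  have V: "variance_reduced u \<gamma> (\<alpha> * \<Lambda>) n b (\<lambda>B x w. \<alpha> *\<^sub>R estimator B x w)
      (\<lambda>x. \<alpha> * (F x - F xstar)) (\<lambda>x. \<alpha> *\<^sub>R grad F x) xstar"
    using rates \<alpha>(1) m_le by (intro variance_reduced_scaled) (auto simp: m_def')
  interpret V: variance_reduced u \<gamma> "\<alpha> * \<Lambda>" n b "\<lambda>B x w. \<alpha> *\<^sub>R estimator B x w"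
      "\<lambda>x. \<alpha> * (F x - F xstar)" "\<lambda>x. \<alpha> *\<^sub>R grad F x" xstar
    by (rule V)
  have gap: "0 \<le> F x0 - F xstar" using minimizer by simp
  have pot: "V.potential k x0 x0 1 \<le> \<phi>0"
  proof -
    have "V.C / p * \<alpha> \<le> 8 * \<alpha>\<^sup>2 * \<Lambda> / (p * (3 - 2 * p))"
    proof -
      have "V.C \<le> 8 * scaled_step u / (1 + 2 * u^2)" using scaled_step_weight[of u] u by (simp add: V.C_def)
      then have "\<alpha> / p * V.C \<le> \<alpha> / p * (8 * scaled_step u / (3 - 2 * p))"
        using \<alpha>(1) p u(3) by (intro mult_left_mono) auto
      also have "\<dots> = 8 * \<alpha>\<^sup>2 * \<Lambda> / (p * (3 - 2 * p))"
        by (simp add: \<alpha>(2)[symmetric] power2_eq_square)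
      finally show ?thesis by (simp add: mult.commute)
    qed
    from mult_right_mono[OF this gap] show ?thesis
      by (simp add: V.potential_def V.h_def V.c_def eta_def V.p_def u(3)[symmetric] assms(14))
  qed
  have \<phi>0: "0 \<le> \<phi>0"
    using gap \<Lambda> p by (simp add: assms(14) add_nonneg_nonneg)
  have \<rho>: "V.\<rho> = 1 - \<delta>" using \<gamma>(3) by (simp add: V.\<rho>_def V.p_def u(3)[symmetric])
  have "ln (1 / \<epsilon>) \<le> \<delta> * real k"
  proof -
    have cost: "0 < iteration_cost n b p"
      using p b_in by (simp add: iteration_cost_def add_pos_nonneg)
    have contraction: "3 * zeta_p p / 2 * (\<Lambda> / \<mu>) = 1 / (2 * (2/3 * \<alpha> * \<mu>))"
      using \<Lambda> zeta mu_pos by (simp add: assms(13))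
    have reset: "1 / p = 1 / (2 * (1/2 * p))" by simp
    have max_inverse: "max (1 / (2 * x)) (1 / (2 * y)) = 1 / (2 * min x y)" if "0 < x" "0 < y" for x y :: real
      using that by (auto simp: max_def min_def field_simps)
    have "max (3 * zeta_p p / 2 * (\<Lambda> / \<mu>)) (1 / p) = 1 / (2 * \<delta>)"
      unfolding contraction \<delta>_def by (subst reset, rule max_inverse) (use \<alpha>(1) mu_pos p in auto)
    then have "iteration_cost n b p * (ln (1 / \<epsilon>) / \<delta>) \<le> iteration_cost n b p * real k"
      using assms(16) by (simp add: total_complexity_def mult.commute)
    then have "ln (1 / \<epsilon>) / \<delta> \<le> real k" using cost by (simp only: mult_le_cancel_left_pos)
    then show ?thesis using \<delta>(1) by (simp add: field_simps)
  qed
  then have rate: "V.\<rho> ^ k \<le> \<epsilon>"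
  proof -
    assume le: "ln (1 / \<epsilon>) \<le> \<delta> * real k"
    have "V.\<rho> ^ k \<le> exp (- \<delta>) ^ k"
      using V.rho_bounds(2) exp_ge_add_one_self[of "- \<delta>"] by (intro power_mono) (auto simp: \<rho>)
    also have "\<dots> = exp (- (\<delta> * real k))" by (simp add: exp_of_nat_mult[symmetric] mult.commute)
    also have "\<dots> \<le> exp (ln \<epsilon>)"
    proof -
      have "- (\<delta> * real k) \<le> ln \<epsilon>" using le \<open>\<epsilon> > 0\<close> by (simp add: ln_div)
      then show ?thesis by (simp only: exp_le_cancel_iff)
    qed
    finally show ?thesis using \<open>\<epsilon> > 0\<close> by simp
  qed
  have "measure_pmf.expectation (lsvrgd n f b p \<alpha> x0 k) (\<lambda>(x, w, a). (norm (x - xstar))\<^sup>2)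
      = V.expected_dist k x0 x0 1"
    using expectation_lsvrgd[of p \<gamma> "\<alpha> * \<Lambda>" \<alpha>] V p \<alpha>(1) unfolding u_def by blast
  also have "\<dots> \<le> V.\<rho> ^ k * V.potential k x0 x0 1"
    by (rule V.expected_dist_le_potential) auto
  also have "\<dots> \<le> V.\<rho> ^ k * \<phi>0"
    using pot V.rho_bounds(2) by (intro mult_left_mono) auto
  also have "\<dots> \<le> \<epsilon> * \<phi>0" using rate \<phi>0 by (rule mult_right_mono)
  finally show ?thesis .
qed

end
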